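(* Let $m$ be a positive integer and let $H$ be a tropical curve which is admissible, i.e. the minimal lattice width of its Newton polygon is at least $m$. Let $P\in H$ be a point which is not a vertex of $H$ and suppose that $\mu^{\mathrm{trop}}_P(H)=m$ (multiplicity in the intermediate sense). Then $\mathrm{area}(\mathfrak{Infl}(P))\ge \frac12 m^2$, that is, $$\sum_{V\in\mathfrak I(P)}\mathrm{area}(d(V))\ \ge\ \frac12 m^2 .$$ Furthermore, if $E\subset H$ is an edge to which $P$ belongs, then the lattice length of $d(E)$ is at least $m$.
   Context: Tropical curves. Let $\mathcal A\subset\mathbb Z^2$ be finite and non-empty, $c_{ij}\in\mathbb R$ for $(i,j)\in\mathcal A$, and $f(X,Y)=\max_{(i,j)\in\mathcal A}(iX+jY+c_{ij})$. The tropical curve $H$ defined by $f$ is the set of points of $\mathbb R^2$ where this maximum is attained for at least two $(i,j)\in\mathcal A$. Its Newton polygon is $\Delta=\mathrm{ConvHull}(\mathcal A)$. For $Q=(Q_1,Q_2)\in\mathbb R^2$ let $d(Q)$ be the convex hull of those $(i,j)\in\mathcal A$ with $iQ_1+jQ_2+c_{ij}=f(Q)$. A point $Q\in H$ is a vertex of $H$ if $d(Q)$ is 2-dimensional; the edges of $H$ are the closures of the connected components of $H$ minus its vertices. For an edge $E$, $d(E)$ denotes the segment $d(Q)$ for any $Q$ in the relative interior of $E$ (independent of $Q$); it is perpendicular to $E$. The polygons $d(V)$ ($V$ a vertex) and segments $d(E)$ are the faces and edges of the dual subdivision of $\Delta$. The weight of $E$ is the lattice length of $d(E)$. A tropical curve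 is regarded together with the weights of its edges; then $f$ is determined, up to adding an integer affine function $iX+jY+c$ and up to coefficients that do not influence $f$, and all notions below do not depend on the choice of $f$. Directions, width. $P(\mathbb Z^2)$ is the set of directions in $\mathbb Z^2$; each direction $u$ is represented by a primitive vector $(u_1,u_2)\in\mathbb Z^2$, $\gcd(u_1,u_2)=1$, unique up to sign. For compact $B\subset\mathbb R^2$, the lattice width in direction $u$ is $\omega_u(B)=\max_{x,y\in B}(u_1,u_2)\cdot(x-y)$, and the minimal lattice width is $\omega(B)=\min_{u\in P(\mathbb Z^2)}\omega_u(B)$. The lattice length of a segment parallel to a primitive integer vector $(p,q)$ is its Euclidean length divided by $\sqrt{p^2+q^2}$. $m$-thickness. A compact set $B\subset\mathbb R^2$ is $m$-thick if one of the following holds: $B$ is empty; $\mathrm{ConvHull}(B)$ is 1-dimensional, of rational slope (vertical allowed), with lattice length at least $m$; $\mathrm{ConvHull}(B)$ is 2-dimensional and for each $u\in P(\mathbb Z^2)$ with $\omega_u(\mathrm{ConvHull}(B))=m-a_u$, $a_u>0$, $\mathrm{ConvHull}(B)$ has two sides perpendicular to $u$, each of lattice length at least $a_u$. Multiplicity in the intermediate sense. Suppose first $P=(0,0)\in H$. Let $\widetilde{\mathcal A}=\mathrm{ConvHull}\{(i,j,s): (i,j)\in\mathcal A,\ s\le c_{ij}\}\subset\mathbb R^3$ (the extended Newton polyhedron) and for $\mu\in\mathbb R$ let $\widetilde{\mathcal A}_\mu$ be the projection to the first two coordinates of the section of $\widetilde{\mathcal A}$ by the plane $z=\mu$. Then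 $P$ is of multiplicity at least $m$ on $H$ in the intermediate sense, written $\mu^{\mathrm{trop}}_P(H)\ge m$, if $\widetilde{\mathcal A}_\mu$ is $m$-thick for every $\mu\in\mathbb R$. For general $P=(P_1,P_2)\in H$ one translates $P$ to the origin, i.e. replaces $c_{ij}$ by $c_{ij}+iP_1+jP_2$. We write $\mu^{\mathrm{trop}}_P(H)=m$ if $\mu^{\mathrm{trop}}_P(H)\ge m$ holds but $\mu^{\mathrm{trop}}_P(H)\ge m+1$ does not. Influenced set. For $Q\in H$ and $u\in P(\mathbb Z^2)$ let $l_Q(u)$ be the line through $Q$ in direction $u$, let $E_Q(u)$ (the long edge) be the connected component of $H\cap l_Q(u)$ containing $Q$, and let $\mathfrak I_Q(u)$ be the set of vertices of $H$ lying on $E_Q(u)$. Put $\mathfrak I(Q)=\bigcup_{u\in P(\mathbb Z^2)}\mathfrak I_Q(u)$ (a set, not a multiset), and let $\mathfrak{Infl}(Q)$ be the collection of faces $d(V)$, $V\in\mathfrak I(Q)$. If $Q$ is not a vertex of $H$, $\mathrm{area}(\mathfrak{Infl}(Q))$ is the sum of the areas of these faces. *)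

theory Defs
  imports "HOL-Analysis.Analysis"
begin

definition of_lattice :: "int \<times> int \<Rightarrow> real \<times> real" where
  "of_lattice a = (of_int (fst a), of_int (snd a))"

text \<open>
  Every direction is represented here by both of its primitive vectors \<open>u\<close> and \<open>-u\<close>;
  nothing below depends on the sign.
\<close>

definition primitive :: "int \<times> int \<Rightarrow> bool" where
  "primitive u \<longleftrightarrow> coprime (fst u) (snd u)"

definition width_dir :: "int \<times> int \<Rightarrow> (real \<times> real) set \<Rightarrow> real" where
  "width_dir u B = Sup {of_lattice u \<bullet> (x - y) | x y. x \<in> B \<and> y \<in> B}"

definition min_width :: "(real \<times> real) set \<Rightarrow> real" where
  "min_width B = Inf {width_dir u B | u. primitive u}"

definition parallel_to :: "(real \<times> real) set \<Rightarrow> int \<times> int \<Rightarrow> bool" where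
  "parallel_to S v \<longleftrightarrow> (\<forall>x\<in>S. \<forall>y\<in>S. \<exists>t. x - y = t *\<^sub>R of_lattice v)"

definition perpendicular_to :: "(real \<times> real) set \<Rightarrow> int \<times> int \<Rightarrow> bool" where
  "perpendicular_to S u \<longleftrightarrow> (\<forall>x\<in>S. \<forall>y\<in>S. of_lattice u \<bullet> (x - y) = 0)"

text \<open>
  For a non-degenerate segment of rational slope the primitive vector chosen below is unique
  up to sign, so its norm is well defined. The value is meaningless for irrational slopes.
\<close>

definition lattice_length :: "(real \<times> real) set \<Rightarrow> real" where
  "lattice_length S = diameter S / norm (of_lattice (SOME v. primitive v \<and> parallel_to S v))"

text \<open>
  A tropical polynomial is given by its finite non-empty support \<open>A\<close> and its coefficients
  \<open>c\<close>, of which only the values on \<open>A\<close> matter.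
\<close>

definition monomial_value :: "(int \<times> int \<Rightarrow> real) \<Rightarrow> int \<times> int \<Rightarrow> real \<times> real \<Rightarrow> real" where
  "monomial_value c a Q = of_int (fst a) * fst Q + of_int (snd a) * snd Q + c a"

definition trop_poly ::
  "(int \<times> int) set \<Rightarrow> (int \<times> int \<Rightarrow> real) \<Rightarrow> real \<times> real \<Rightarrow> real" where
  "trop_poly A c Q = Max ((\<lambda>a. monomial_value c a Q) ` A)"

definition maximizers ::
  "(int \<times> int) set \<Rightarrow> (int \<times> int \<Rightarrow> real) \<Rightarrow> real \<times> real \<Rightarrow> (int \<times> int) set" where
  "maximizers A c Q = {a \<in> A. monomial_value c a Q = trop_poly A c Q}"

definition trop_curve ::
  "(int \<times> int) set \<Rightarrow> (int \<times> int \<Rightarrow> real) \<Rightarrow> (real \<times> real) set" where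
  "trop_curve A c = {Q. card (maximizers A c Q) \<ge> 2}"

definition newton_polygon :: "(int \<times> int) set \<Rightarrow> (real \<times> real) set" where
  "newton_polygon A = convex hull (of_lattice ` A)"

definition admissible :: "nat \<Rightarrow> (int \<times> int) set \<Rightarrow> bool" where
  "admissible m A \<longleftrightarrow> min_width (newton_polygon A) \<ge> real m"

definition dual_cell ::
  "(int \<times> int) set \<Rightarrow> (int \<times> int \<Rightarrow> real) \<Rightarrow> real \<times> real \<Rightarrow> (real \<times> real) set" where
  "dual_cell A c Q = convex hull (of_lattice ` maximizers A c Q)"

definition vertices ::
  "(int \<times> int) set \<Rightarrow> (int \<times> int \<Rightarrow> real) \<Rightarrow> (real \<times> real) set" where
  "vertices A c = {Q \<in> trop_curve A c. aff_dim (dual_cell A c Q) = 2}"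

definition edges ::
  "(int \<times> int) set \<Rightarrow> (int \<times> int \<Rightarrow> real) \<Rightarrow> (real \<times> real) set set" where
  "edges A c = closure ` components (trop_curve A c - vertices A c)"

text \<open>The dual cell is the same for all points of the relative interior of an edge.\<close>

definition dual_edge ::
  "(int \<times> int) set \<Rightarrow> (int \<times> int \<Rightarrow> real) \<Rightarrow> (real \<times> real) set \<Rightarrow> (real \<times> real) set" where
  "dual_edge A c E = dual_cell A c (SOME Q. Q \<in> rel_interior E)"

text \<open>
  The notion is meant for compact \<open>B\<close>; it is applied only to sections of the extended Newton
  polyhedron, which are compact. The sides of a two-dimensional polygon are its facets.
  A single point is not thick.
\<close>

definition thick :: "nat \<Rightarrow> (real \<times> real) set \<Rightarrow> bool" where
  "thick m B \<longleftrightarrow>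
     B = {} \<or>
     (aff_dim (convex hull B) = 1 \<and>
      (\<exists>v. primitive v \<and> parallel_to (convex hull B) v) \<and>
      lattice_length (convex hull B) \<ge> real m) \<or>
     (aff_dim (convex hull B) = 2 \<and>
      (\<forall>u a. primitive u \<and> a > 0 \<and> width_dir u (convex hull B) = real m - a \<longrightarrow>
        (\<exists>S T. S \<noteq> T \<and>
           S facet_of (convex hull B) \<and> perpendicular_to S u \<and> lattice_length S \<ge> a \<and>
           T facet_of (convex hull B) \<and> perpendicular_to T u \<and> lattice_length T \<ge> a)))"

definition ext_newton_polyhedron ::
  "(int \<times> int) set \<Rightarrow> (int \<times> int \<Rightarrow> real) \<Rightarrow> ((real \<times> real) \<times> real) set" where
  "ext_newton_polyhedron A c = convex hull {(of_lattice a, s) | a s. a \<in> A \<and> s \<le> c a}"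

definition newton_section ::
  "(int \<times> int) set \<Rightarrow> (int \<times> int \<Rightarrow> real) \<Rightarrow> real \<Rightarrow> (real \<times> real) set" where
  "newton_section A c \<mu> = {x. (x, \<mu>) \<in> ext_newton_polyhedron A c}"

text \<open>Coefficients of the curve translated so that \<open>P\<close> becomes the origin.\<close>

definition recentre ::
  "real \<times> real \<Rightarrow> (int \<times> int \<Rightarrow> real) \<Rightarrow> int \<times> int \<Rightarrow> real" where
  "recentre P c a = c a + of_int (fst a) * fst P + of_int (snd a) * snd P"

definition mult_ge ::
  "(int \<times> int) set \<Rightarrow> (int \<times> int \<Rightarrow> real) \<Rightarrow> real \<times> real \<Rightarrow> nat \<Rightarrow> bool" where
  "mult_ge A c P m \<longleftrightarrow> (\<forall>\<mu>. thick m (newton_section A (recentre P c) \<mu>))"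

definition mult_eq ::
  "(int \<times> int) set \<Rightarrow> (int \<times> int \<Rightarrow> real) \<Rightarrow> real \<times> real \<Rightarrow> nat \<Rightarrow> bool" where
  "mult_eq A c P m \<longleftrightarrow> mult_ge A c P m \<and> \<not> mult_ge A c P (m + 1)"

definition lattice_line :: "real \<times> real \<Rightarrow> int \<times> int \<Rightarrow> (real \<times> real) set" where
  "lattice_line Q u = {Q + t *\<^sub>R of_lattice u | t. True}"

definition long_edge ::
  "(int \<times> int) set \<Rightarrow> (int \<times> int \<Rightarrow> real) \<Rightarrow> real \<times> real \<Rightarrow> int \<times> int \<Rightarrow> (real \<times> real) set" where
  "long_edge A c Q u = connected_component_set (trop_curve A c \<inter> lattice_line Q u) Q"

definition influenced_dir ::
  "(int \<times> int) set \<Rightarrow> (int \<times> int \<Rightarrow> real) \<Rightarrow> real \<times> real \<Rightarrow> int \<times> int \<Rightarrow> (real \<times> real) set" where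
  "influenced_dir A c Q u = vertices A c \<inter> long_edge A c Q u"

definition influenced ::
  "(int \<times> int) set \<Rightarrow> (int \<times> int \<Rightarrow> real) \<Rightarrow> real \<times> real \<Rightarrow> (real \<times> real) set" where
  "influenced A c Q = (\<Union>u\<in>{u. primitive u}. influenced_dir A c Q u)"

text \<open>
  A vertex is determined by its dual face, and there are finitely many vertices, so summing
  over vertices is the same as summing over the collection of dual faces.
\<close>

definition area_infl ::
  "(int \<times> int) set \<Rightarrow> (int \<times> int \<Rightarrow> real) \<Rightarrow> real \<times> real \<Rightarrow> real" where
  "area_infl A c Q = (\<Sum>V\<in>influenced A c Q. measure lborel (dual_cell A c V))"

end

theory Submission
  imports Defs
begin

text \<open>
  Translate \<open>P\<close> to the origin and let \<open>u\<close> be the primitive vector orthogonal to the segment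
  \<open>d(P)\<close>, so that the edge through \<open>P\<close> runs in direction \<open>u\<close>. Call \<open>u \<bullet> x\<close> the height of a point
  \<open>x\<close> of the Newton polygon, and the lines of constant height rows. The extended Newton polyhedron is
  the region below the graph of a concave function \<open>F\<close>, and \<open>d(P)\<close>, which lies in a single row of
  height \<open>y0\<close>, is the locus where \<open>F\<close> is maximal.

  As the level \<open>\<mu>\<close> sinks, the section \<open>{F \<ge> \<mu>}\<close> grows out of \<open>d(P)\<close>. Its sides perpendicular to
  \<open>u\<close> can only be its highest and its lowest row, so thickness says: if the section has width
  \<open>m - a\<close> with \<open>a > 0\<close>, both extreme rows have lattice length at least \<open>a\<close>. On the other hand, on
  the highest and on the lowest row of a section at a level that \<open>F\<close> attains as its maximum on that
  row, the points of the row belong to the dual cell \<open>d(t u)\<close> for which the line of slope \<open>-t\<close>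
  supports the row maxima of \<open>F\<close> at this height. Hence the cells \<open>d(t u)\<close> sweep out the rows of the
  polygon, and thickness bounds the lengths of these rows from below (\<open>long_row\<close>).

  A row of positive length in \<open>d(t u)\<close> makes \<open>t u\<close> a point of the curve. The cells of the points
  between the origin and \<open>t u\<close> lie at intermediate heights, so they too contain such rows, or the
  segment \<open>d(P)\<close>, and the curve contains the whole segment from the origin to \<open>t u\<close>. A cell \<open>d(t u)\<close> with a long row at a
  non-integral height is two-dimensional, because it also has lattice points: \<open>t u\<close> is a vertex on
  the long edge (\<open>long_rows_on_long_edge\<close>).

  For the area fix \<open>0 < s < m\<close> and take the highest level at which the width is still at least
  \<open>m - s\<close>, which is a level below the maximum. All levels above it have width less than \<open>m - s\<close>,
  hence extreme rows of length at least \<open>s\<close>; so for almost every height in an interval of length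
  at least \<open>m - s\<close> an influenced face has a row of length at least \<open>s\<close>. Integrating over \<open>s\<close> gives the
  area \<open>\<integral>\<^sub>0\<^sup>m (m - s) ds = m\<^sup>2 / 2\<close> (\<open>area_ge_of_long_rows\<close>).

  For the last assertion, \<open>d(P)\<close> itself is the section at the top level, and it is
  one-dimensional, so thickness bounds its lattice length. It equals \<open>d(E)\<close> because the set of
  maximizing monomials is constant on each component of the curve minus its vertices
  (\<open>component_eq_cell\<close>).
\<close>

section \<open>The extended Newton polyhedron and the dual cells\<close>

lemma monomial_value_inner: "monomial_value c a Q = of_lattice a \<bullet> Q + c a"
  by (simp add: monomial_value_def of_lattice_def inner_prod_def)

lemma monomial_value_recentre:
  "monomial_value (recentre P c) a Q = monomial_value c a (P + Q)"
  by (simp add: monomial_value_def recentre_def algebra_simps)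

lemma maximizers_recentre: "maximizers A (recentre P c) Q = maximizers A c (P + Q)"
  by (simp add: maximizers_def trop_poly_def monomial_value_recentre)

lemma dual_cell_recentre: "dual_cell A (recentre P c) Q = dual_cell A c (P + Q)"
  by (simp add: dual_cell_def maximizers_recentre)

lemma inj_of_lattice: "inj of_lattice"
  by (auto simp: inj_def of_lattice_def prod_eq_iff)

text \<open>
  Only the part of the extended polyhedron spanned by the lifted monomials; unlike the whole
  polyhedron it is compact, so extremal levels are attained on it.
\<close>

definition lifted_polytope ::
  "(int \<times> int) set \<Rightarrow> (int \<times> int \<Rightarrow> real) \<Rightarrow> ((real \<times> real) \<times> real) set" where
  "lifted_polytope A c = convex hull ((\<lambda>a. (of_lattice a, c a)) ` A)"

lemma convex_ext_newton_polyhedron: "convex (ext_newton_polyhedron A c)"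
  by (simp add: ext_newton_polyhedron_def)

text \<open>
  Subtracting a constant from the last coordinate maps the generating rays into themselves.
\<close>

lemma ext_newton_downward:
  assumes "(x, \<nu>) \<in> ext_newton_polyhedron A c" "\<mu> \<le> \<nu>"
  shows "(x, \<mu>) \<in> ext_newton_polyhedron A c"
proof -
  define S where "S = {(of_lattice a, s) | a s. a \<in> A \<and> s \<le> c a}"
  define N where "N = convex hull S"
  have N: "ext_newton_polyhedron A c = N"
    by (simp add: N_def S_def ext_newton_polyhedron_def)
  define D where "D = {p. p + (0, \<mu> - \<nu>) \<in> N}"
  have "convex N" by (simp add: N_def)
  have "convex D"
    unfolding convex_def
  proof (intro ballI allI impI)
    fix p q and k l :: real
    assume "p \<in> D" "q \<in> D" and kl: "0 \<le> k" "0 \<le> l" "k + l = 1"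
    then have "k *\<^sub>R (p + (0, \<mu> - \<nu>)) + l *\<^sub>R (q + (0, \<mu> - \<nu>)) \<in> N"
      by (intro convexD[OF \<open>convex N\<close>]) (auto simp: D_def)
    moreover have "k *\<^sub>R (p + (0, \<mu> - \<nu>)) + l *\<^sub>R (q + (0, \<mu> - \<nu>)) =
        (k *\<^sub>R p + l *\<^sub>R q) + (k + l) *\<^sub>R (0, \<mu> - \<nu>)"
      by (simp only: scaleR_add_right scaleR_add_left add.assoc add.left_commute)
    ultimately show "k *\<^sub>R p + l *\<^sub>R q \<in> D" using kl by (simp add: D_def)
  qed
  moreover have "S \<subseteq> D"
  proof
    fix p assume "p \<in> S"
    then obtain a s where p: "p = (of_lattice a, s)" "a \<in> A" "s \<le> c a"
      by (auto simp: S_def)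
    then have "p + (0, \<mu> - \<nu>) = (of_lattice a, s + (\<mu> - \<nu>))" "s + (\<mu> - \<nu>) \<le> c a"
      using assms(2) by auto
    then have "p + (0, \<mu> - \<nu>) \<in> S" using p(2) unfolding S_def by blast
    then show "p \<in> D" unfolding D_def N_def by (auto intro: hull_inc)
  qed
  ultimately have "N \<subseteq> D" unfolding N_def by (intro hull_minimal)
  with assms(1) N have "(x, \<nu>) \<in> D" by auto
  then show ?thesis by (simp add: D_def N)
qed

lemma ext_newton_iff_below_lifted:
  "(x, \<mu>) \<in> ext_newton_polyhedron A c \<longleftrightarrow> (\<exists>\<nu>\<ge>\<mu>. (x, \<nu>) \<in> lifted_polytope A c)"
proof
  define B where "B = {p. \<exists>\<nu>\<ge>snd p. (fst p, \<nu>) \<in> lifted_polytope A c}"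
  have "convex B"
    unfolding convex_def
  proof (intro ballI allI impI)
    fix p q and k l :: real
    assume "p \<in> B" "q \<in> B" and kl: "0 \<le> k" "0 \<le> l" "k + l = 1"
    then obtain \<nu> \<nu>' where h: "\<nu> \<ge> snd p" "(fst p, \<nu>) \<in> lifted_polytope A c"
      "\<nu>' \<ge> snd q" "(fst q, \<nu>') \<in> lifted_polytope A c" by (auto simp: B_def)
    have "k *\<^sub>R (fst p, \<nu>) + l *\<^sub>R (fst q, \<nu>') \<in> lifted_polytope A c"
      using h kl unfolding lifted_polytope_def by (intro convexD) auto
    moreover have "k * \<nu> + l * \<nu>' \<ge> k * snd p + l * snd q"
      using h kl by (intro add_mono mult_left_mono) auto
    ultimately show "k *\<^sub>R p + l *\<^sub>R q \<in> B" unfolding B_def by auto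
  qed
  moreover have "{(of_lattice a, s) | a s. a \<in> A \<and> s \<le> c a} \<subseteq> B"
    by (force simp: B_def lifted_polytope_def intro: hull_inc)
  ultimately have "ext_newton_polyhedron A c \<subseteq> B"
    unfolding ext_newton_polyhedron_def by (intro hull_minimal)
  then show "(x, \<mu>) \<in> ext_newton_polyhedron A c \<Longrightarrow> \<exists>\<nu>\<ge>\<mu>. (x, \<nu>) \<in> lifted_polytope A c"
    by (force simp: B_def)
next
  have "lifted_polytope A c \<subseteq> ext_newton_polyhedron A c"
    unfolding lifted_polytope_def ext_newton_polyhedron_def by (intro hull_mono) auto
  then show "\<exists>\<nu>\<ge>\<mu>. (x, \<nu>) \<in> lifted_polytope A c \<Longrightarrow> (x, \<mu>) \<in> ext_newton_polyhedron A c"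
    by (auto intro: ext_newton_downward)
qed

lemma of_lattice_in_ext_newton:
  "a \<in> A \<Longrightarrow> \<mu> \<le> c a \<Longrightarrow> (of_lattice a, \<mu>) \<in> ext_newton_polyhedron A c"
  unfolding ext_newton_polyhedron_def by (rule hull_inc) blast

lemma compact_lifted_polytope: "finite A \<Longrightarrow> compact (lifted_polytope A c)"
  unfolding lifted_polytope_def by (intro finite_imp_compact_convex_hull) auto

lemma newton_section_eq_image:
  "newton_section A c \<mu> = fst ` (lifted_polytope A c \<inter> {p. \<mu> \<le> snd p})"
  by (force simp: newton_section_def ext_newton_iff_below_lifted)

lemma compact_newton_section: "finite A \<Longrightarrow> compact (newton_section A c \<mu>)"
  unfolding newton_section_eq_image
  by (intro compact_continuous_image compact_Int_closed compact_lifted_polytope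
        closed_Collect_le continuous_intros)

lemma convex_newton_section: "convex (newton_section A c \<mu>)"
  unfolding convex_def
proof (intro ballI allI impI)
  fix x y and k l :: real
  assume "x \<in> newton_section A c \<mu>" "y \<in> newton_section A c \<mu>"
    and kl: "0 \<le> k" "0 \<le> l" "k + l = 1"
  then have "k *\<^sub>R (x, \<mu>) + l *\<^sub>R (y, \<mu>) \<in> ext_newton_polyhedron A c"
    by (intro convexD[OF convex_ext_newton_polyhedron]) (auto simp: newton_section_def)
  moreover have "k * \<mu> + l * \<mu> = \<mu>" using kl by (simp flip: distrib_right)
  ultimately show "k *\<^sub>R x + l *\<^sub>R y \<in> newton_section A c \<mu>" by (simp add: newton_section_def)
qed

locale tropical_polynomial =
  fixes A :: "(int \<times> int) set" and c :: "int \<times> int \<Rightarrow> real"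
  assumes finite_support: "finite A" and support_nonempty: "A \<noteq> {}"
begin

abbreviation N where "N \<equiv> ext_newton_polyhedron A c"

lemma monomial_le_trop_poly: "a \<in> A \<Longrightarrow> of_lattice a \<bullet> Q + c a \<le> trop_poly A c Q"
  using finite_support by (simp add: trop_poly_def flip: monomial_value_inner)

lemma maximizers_iff:
  "a \<in> maximizers A c Q \<longleftrightarrow> a \<in> A \<and> of_lattice a \<bullet> Q + c a = trop_poly A c Q"
  by (simp add: maximizers_def monomial_value_inner)

lemma maximizers_nonempty: "maximizers A c Q \<noteq> {}"
proof -
  have "trop_poly A c Q \<in> (\<lambda>a. monomial_value c a Q) ` A"
    unfolding trop_poly_def using finite_support support_nonempty by (intro Max_in) auto
  then obtain a where "a \<in> A" "trop_poly A c Q = monomial_value c a Q" by blast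
  then have "a \<in> maximizers A c Q" by (simp add: maximizers_def)
  then show ?thesis by blast
qed

lemma finite_maximizers: "finite (maximizers A c Q)"
  using finite_support by (simp add: maximizers_def)

text \<open>
  The value of the tropical polynomial at \<open>Q\<close> is the support function of the polyhedron in direction
  \<open>(Q, 1)\<close>, and the face where this direction is maximal lies over \<open>d(Q)\<close>. Both facts come from
  one convex set that contains the generators: the open half-space together with the part of its
  boundary over \<open>d(Q)\<close>.
\<close>

lemma ext_newton_support:
  assumes "(x, \<mu>) \<in> N"
  shows "x \<bullet> Q + \<mu> < trop_poly A c Q \<or> x \<bullet> Q + \<mu> = trop_poly A c Q \<and> x \<in> dual_cell A c Q"
proof -
  define T where "T = {p. fst p \<bullet> Q + snd p < trop_poly A c Q \<or>
    fst p \<bullet> Q + snd p = trop_poly A c Q \<and> fst p \<in> dual_cell A c Q}"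
  have "convex T"
    unfolding convex_def
  proof (intro ballI allI impI)
    fix p q and k l :: real
    assume pq: "p \<in> T" "q \<in> T" and kl: "0 \<le> k" "0 \<le> l" "k + l = 1"
    define h where "h p = fst p \<bullet> Q + snd p" for p :: "(real \<times> real) \<times> real"
    have lin: "h (k *\<^sub>R p + l *\<^sub>R q) = k * h p + l * h q"
      by (simp add: h_def inner_add_left algebra_simps)
    have le: "h p \<le> trop_poly A c Q" "h q \<le> trop_poly A c Q"
      using pq by (auto simp: T_def h_def)
    show "k *\<^sub>R p + l *\<^sub>R q \<in> T"
    proof (cases "k = 0 \<or> l = 0")
      case True
      then show ?thesis using pq kl by auto
    next
      case False
      then have pos: "k > 0" "l > 0" using kl by auto
      have eq: "k * trop_poly A c Q + l * trop_poly A c Q = trop_poly A c Q"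
        using kl by (simp flip: distrib_right)
      show ?thesis
      proof (cases "h p < trop_poly A c Q \<or> h q < trop_poly A c Q")
        case True
        then have "k * h p + l * h q < k * trop_poly A c Q + l * trop_poly A c Q"
          using le pos by (auto intro: add_less_le_mono add_le_less_mono)
        then have "h (k *\<^sub>R p + l *\<^sub>R q) < trop_poly A c Q" using eq lin by simp
        then show ?thesis by (simp add: T_def h_def)
      next
        case False
        then have "h p = trop_poly A c Q" "h q = trop_poly A c Q" using le by auto
        then have "h (k *\<^sub>R p + l *\<^sub>R q) = trop_poly A c Q" using lin eq by simp
        moreover have "fst p \<in> dual_cell A c Q" "fst q \<in> dual_cell A c Q"
          using pq False by (auto simp: T_def h_def)
        then have "k *\<^sub>R fst p + l *\<^sub>R fst q \<in> dual_cell A c Q"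
          using kl unfolding dual_cell_def by (intro convexD) auto
        ultimately show ?thesis by (simp add: T_def h_def)
      qed
    qed
  qed
  moreover have "{(of_lattice a, s) | a s. a \<in> A \<and> s \<le> c a} \<subseteq> T"
  proof
    fix p assume "p \<in> {(of_lattice a, s) | a s. a \<in> A \<and> s \<le> c a}"
    then obtain a s where p: "p = (of_lattice a, s)" and a: "a \<in> A" "s \<le> c a" by blast
    show "p \<in> T"
      unfolding p
    proof (cases "of_lattice a \<bullet> Q + s < trop_poly A c Q")
      case True
      then show "(of_lattice a, s) \<in> T" by (simp add: T_def)
    next
      case False
      then have "of_lattice a \<bullet> Q + s = trop_poly A c Q" "s = c a"
        using monomial_le_trop_poly[OF a(1), of Q] a(2) by auto
      moreover then have "a \<in> maximizers A c Q" using a by (simp add: maximizers_iff)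
      ultimately show "(of_lattice a, s) \<in> T" by (auto simp: T_def dual_cell_def intro: hull_inc)
    qed
  qed
  ultimately have "N \<subseteq> T"
    unfolding ext_newton_polyhedron_def by (intro hull_minimal)
  with assms show ?thesis by (auto simp: T_def)
qed

lemma ext_newton_le: "(x, \<mu>) \<in> N \<Longrightarrow> x \<bullet> Q + \<mu> \<le> trop_poly A c Q"
  using ext_newton_support[of x \<mu> Q] by auto

text \<open>
  The converse direction of the duality: \<open>d(Q)\<close> lifts to the face of the polyhedron selected by \<open>Q\<close>.
\<close>

lemma dual_cell_lift:
  assumes "x \<in> dual_cell A c Q"
  shows "(x, trop_poly A c Q - x \<bullet> Q) \<in> N"
proof -
  define D where "D = {x. (x, trop_poly A c Q - x \<bullet> Q) \<in> N}"
  have "convex D"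
    unfolding convex_def
  proof (intro ballI allI impI)
    fix x y and k l :: real
    assume xy: "x \<in> D" "y \<in> D" and kl: "0 \<le> k" "0 \<le> l" "k + l = 1"
    have "k *\<^sub>R (x, trop_poly A c Q - x \<bullet> Q) + l *\<^sub>R (y, trop_poly A c Q - y \<bullet> Q) \<in> N"
      using xy kl by (intro convexD[OF convex_ext_newton_polyhedron]) (auto simp: D_def)
    moreover have "k * (trop_poly A c Q - x \<bullet> Q) + l * (trop_poly A c Q - y \<bullet> Q)
        = trop_poly A c Q - (k *\<^sub>R x + l *\<^sub>R y) \<bullet> Q"
    proof -
      have "k * trop_poly A c Q + l * trop_poly A c Q = trop_poly A c Q"
        using kl(3) by (simp flip: distrib_right)
      then show ?thesis by (simp add: inner_add_left right_diff_distrib)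
    qed
    ultimately show "k *\<^sub>R x + l *\<^sub>R y \<in> D" by (simp add: D_def)
  qed
  moreover have "of_lattice ` maximizers A c Q \<subseteq> D"
    by (auto simp: D_def maximizers_iff intro!: of_lattice_in_ext_newton)
  ultimately have "dual_cell A c Q \<subseteq> D"
    unfolding dual_cell_def by (intro hull_minimal)
  with assms show ?thesis by (auto simp: D_def)
qed

lemma newton_section_top: "newton_section A c (trop_poly A c 0) = dual_cell A c 0"
  using ext_newton_support[of _ "trop_poly A c 0" 0] dual_cell_lift[of _ 0]
  by (auto simp: newton_section_def)

end

section \<open>Rows and sides perpendicular to a lattice direction\<close>

definition rot :: "int \<times> int \<Rightarrow> int \<times> int" where
  "rot u = (- snd u, fst u)"

lemma primitive_rot: "primitive u \<Longrightarrow> primitive (rot u)"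
  by (simp add: primitive_def rot_def coprime_commute)

lemma of_lattice_nonzero: "primitive u \<Longrightarrow> of_lattice u \<noteq> 0"
  by (auto simp: primitive_def of_lattice_def zero_prod_def)

lemma norm_rot: "norm (of_lattice (rot u)) = norm (of_lattice u)"
  by (simp add: of_lattice_def rot_def norm_prod_def add.commute)

lemma orthogonal_imp_multiple_rot:
  assumes "primitive u" "of_lattice u \<bullet> d = 0"
  obtains r where "d = r *\<^sub>R of_lattice (rot u)"
proof -
  define u1 u2 :: real where "u1 = of_int (fst u)" and "u2 = of_int (snd u)"
  have u: "of_lattice u = (u1, u2)" "of_lattice (rot u) = (- u2, u1)"
    by (simp_all add: u1_def u2_def of_lattice_def rot_def)
  obtain d1 d2 where d: "d = (d1, d2)" by force
  have eq: "u1 * d1 + u2 * d2 = 0" using assms(2) by (simp add: u d inner_prod_def)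
  have nz: "u1 * u1 + u2 * u2 \<noteq> 0"
    using of_lattice_nonzero[OF assms(1)] by (simp add: u zero_prod_def sum_squares_eq_zero_iff)
  define r where "r = (u1 * d2 - u2 * d1) / (u1 * u1 + u2 * u2)"
  have "d1 * (u1 * u1 + u2 * u2) = (u1 * d2 - u2 * d1) * (- u2)"
    using eq by algebra
  moreover have "d2 * (u1 * u1 + u2 * u2) = (u1 * d2 - u2 * d1) * u1"
    using eq by algebra
  ultimately have "d1 = r * - u2" "d2 = r * u1"
    unfolding r_def using nz by (auto simp: field_simps)
  then have "d = r *\<^sub>R of_lattice (rot u)" by (simp add: u d)
  then show thesis by (rule that)
qed

text \<open>
  The choice operator in the definition of the lattice length may return any primitive vector along
  the segment. Coprimality makes the coordinates of two orthogonal primitive vectors divide each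
  other crosswise, so the choice does not affect the norm.
\<close>

lemma norm_eq_of_primitive_orthogonal:
  assumes "primitive u" "primitive v" "of_lattice u \<bullet> of_lattice v = 0"
  shows "norm (of_lattice v) = norm (of_lattice u)"
proof -
  obtain u1 u2 v1 v2 where uv: "u = (u1, u2)" "v = (v1, v2)" by force
  have "real_of_int (u1 * v1 + u2 * v2) = 0"
    using assms(3) by (simp add: uv of_lattice_def inner_prod_def)
  then have eq: "u1 * v1 + u2 * v2 = 0" by linarith
  have cop: "coprime u1 u2" "coprime v1 v2" using assms by (simp_all add: uv primitive_def)
  have e1: "u1 * v1 = v2 * (- u2)" and e2: "u2 * v2 = v1 * (- u1)"
    using eq by (simp_all add: algebra_simps)
  have d1: "u1 dvd v2"
    using cop(1) e1 coprime_dvd_mult_left_iff[of u1 "- u2" v2] dvd_triv_left[of u1 v1] by simp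
  have d2: "v2 dvd u1"
    using cop(2) e1 coprime_dvd_mult_left_iff[of v2 v1 u1] dvd_triv_left[of v2 "- u2"]
    by (simp add: coprime_commute)
  have d3: "u2 dvd v1"
    using cop(1) e2 coprime_dvd_mult_left_iff[of u2 "- u1" v1] dvd_triv_left[of u2 v2]
    by (simp add: coprime_commute)
  have d4: "v1 dvd u2"
    using cop(2) e2 coprime_dvd_mult_left_iff[of v1 v2 u2] dvd_triv_left[of v1 "- u1"] by simp
  have "\<bar>u1\<bar> = \<bar>v2\<bar>" by (rule zdvd_antisym_abs[OF d1 d2])
  moreover have "\<bar>u2\<bar> = \<bar>v1\<bar>" by (rule zdvd_antisym_abs[OF d3 d4])
  ultimately have "u1\<^sup>2 = v2\<^sup>2" "u2\<^sup>2 = v1\<^sup>2" by (metis power2_abs)+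
  then have "real_of_int (u1\<^sup>2) = real_of_int (v2\<^sup>2)" "real_of_int (u2\<^sup>2) = real_of_int (v1\<^sup>2)"
    by simp_all
  then show ?thesis by (simp add: uv of_lattice_def norm_prod_def add.commute)
qed

lemma long_segment_of_lattice_length:
  assumes "primitive u" "compact S" "perpendicular_to S u" "lattice_length S \<ge> s" "s > 0"
  obtains x r where "x \<in> S" "x + r *\<^sub>R of_lattice (rot u) \<in> S" "r \<ge> s"
proof -
  have "diameter S \<noteq> 0" using assms(4,5) by (auto simp: lattice_length_def)
  moreover then have "S \<noteq> {}" by auto
  ultimately obtain x y where xy: "x \<in> S" "y \<in> S" "dist x y = diameter S" "x \<noteq> y"
    using diameter_compact_attained[OF assms(2)] by (metis dist_self)
  have par: "parallel_to S (rot u)"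
    unfolding parallel_to_def using assms(3)
    by (meson orthogonal_imp_multiple_rot[OF assms(1)] perpendicular_to_def)
  define v where "v = (SOME v. primitive v \<and> parallel_to S v)"
  have v: "primitive v" "parallel_to S v"
    using someI[of "\<lambda>v. primitive v \<and> parallel_to S v" "rot u"] par primitive_rot[OF assms(1)]
    by (auto simp: v_def)
  obtain t where t: "x - y = t *\<^sub>R of_lattice v" using v xy unfolding parallel_to_def by blast
  have "t \<noteq> 0" using t xy by auto
  moreover have "of_lattice u \<bullet> (x - y) = 0" using assms(3) xy by (auto simp: perpendicular_to_def)
  ultimately have "of_lattice u \<bullet> of_lattice v = 0" by (simp add: t)
  then have nv: "norm (of_lattice v) = norm (of_lattice u)"
    using norm_eq_of_primitive_orthogonal assms(1) v by blast
  obtain r where r: "x - y = r *\<^sub>R of_lattice (rot u)"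
    using par xy unfolding parallel_to_def by blast
  have pos: "norm (of_lattice u) > 0" using of_lattice_nonzero[OF assms(1)] by simp
  have "diameter S = \<bar>r\<bar> * norm (of_lattice u)"
    using xy(3) r by (simp add: dist_norm norm_rot)
  then have "\<bar>r\<bar> \<ge> s"
    using assms(4) nv pos by (simp add: lattice_length_def v_def[symmetric])
  then consider "r \<ge> s" | "- r \<ge> s" by linarith
  then show thesis
  proof cases
    case 1
    moreover have "y + r *\<^sub>R of_lattice (rot u) = x" using r by (simp add: algebra_simps)
    ultimately show thesis using xy that[of y r] by simp
  next
    case 2
    moreover have "x + (- r) *\<^sub>R of_lattice (rot u) = y" using r by (simp add: algebra_simps)
    ultimately show thesis using xy that[of x "- r"] by simp
  qed
qed

text \<open>
  A facet is the part of \<open>K\<close> in its own affine hull, here a full row. If \<open>K\<close> had points on both sides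
  of this row, a segment joining them would cross the row inside the facet without lying in it,
  against the definition of a face.
\<close>

lemma facet_perpendicular_extreme:
  assumes "primitive u" "convex K" "aff_dim K = 2" "S facet_of K" "perpendicular_to S u"
  obtains k where "S = K \<inter> {x. of_lattice u \<bullet> x = k}"
    and "(\<forall>x\<in>K. of_lattice u \<bullet> x \<le> k) \<or> (\<forall>x\<in>K. k \<le> of_lattice u \<bullet> x)"
proof -
  have face: "S face_of K" and dim: "aff_dim S = 1"
    using assms(3,4) unfolding facet_of_def by simp_all
  have "\<not> (\<exists>a. S \<subseteq> {a})"
  proof
    assume "\<exists>a. S \<subseteq> {a}"
    then obtain a where "S \<subseteq> {a}" by blast
    from aff_dim_subset[OF this] dim show False by simp
  qed
  then obtain p q where pq: "p \<in> S" "q \<in> S" "p \<noteq> q" by blast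
  define k where "k = of_lattice u \<bullet> p"
  have row: "of_lattice u \<bullet> x = k" if "x \<in> S" for x
  proof -
    have "of_lattice u \<bullet> (x - p) = 0"
      using assms(5) pq(1) that unfolding perpendicular_to_def by blast
    then show ?thesis by (simp add: k_def inner_diff_right)
  qed
  have "of_lattice u \<bullet> (q - p) = 0" using row[OF pq(2)] by (simp add: k_def inner_diff_right)
  then obtain r where r: "q - p = r *\<^sub>R of_lattice (rot u)"
    using orthogonal_imp_multiple_rot[OF assms(1)] by metis
  then have "r \<noteq> 0" using pq by auto
  have in_hull: "x \<in> affine hull S" if "of_lattice u \<bullet> x = k" for x
  proof -
    have "of_lattice u \<bullet> (x - p) = 0" using that by (simp add: k_def inner_diff_right)
    then obtain t where t: "x - p = t *\<^sub>R of_lattice (rot u)"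
      using orthogonal_imp_multiple_rot[OF assms(1)] by metis
    have "x = p + (t / r) *\<^sub>R (q - p)" using t r \<open>r \<noteq> 0\<close> by (simp add: algebra_simps)
    then have x: "x = (1 - t / r) *\<^sub>R p + (t / r) *\<^sub>R q" by (simp add: algebra_simps)
    have "p \<in> affine hull S" "q \<in> affine hull S" using pq by (auto intro: hull_inc)
    then show ?thesis unfolding x
      by (intro mem_affine[OF affine_affine_hull]) auto
  qed
  have "S = affine hull S \<inter> K" using face_of_imp_eq_affine_Int[OF assms(2) face] .
  then have S: "S = K \<inter> {x. of_lattice u \<bullet> x = k}"
    using in_hull row by blast
  moreover have "(\<forall>x\<in>K. of_lattice u \<bullet> x \<le> k) \<or> (\<forall>x\<in>K. k \<le> of_lattice u \<bullet> x)"
  proof (rule ccontr)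
    assume "\<not> ?thesis"
    then obtain a b where ab: "a \<in> K" "b \<in> K" "of_lattice u \<bullet> a < k" "k < of_lattice u \<bullet> b"
      by (auto simp: not_le)
    define \<theta> where "\<theta> = (k - of_lattice u \<bullet> a) / (of_lattice u \<bullet> b - of_lattice u \<bullet> a)"
    have \<theta>: "0 < \<theta>" "\<theta> < 1" using ab by (simp_all add: \<theta>_def field_simps)
    define z where "z = (1 - \<theta>) *\<^sub>R a + \<theta> *\<^sub>R b"
    have "z \<in> K" unfolding z_def using ab \<theta> assms(2) by (intro convexD) auto
    moreover have "of_lattice u \<bullet> z = k"
    proof -
      have "of_lattice u \<bullet> z = of_lattice u \<bullet> a + \<theta> * (of_lattice u \<bullet> b - of_lattice u \<bullet> a)"
        by (simp add: z_def inner_add_right algebra_simps)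
      then show ?thesis using ab by (simp add: \<theta>_def)
    qed
    ultimately have "z \<in> S" using S by auto
    moreover have "z \<in> open_segment a b"
      using \<theta> ab by (auto simp: in_segment z_def)
    ultimately have "a \<in> S" using face ab unfolding face_of_def by blast
    then show False using row ab by auto
  qed
  ultimately show thesis by (rule that)
qed

section \<open>Dual cells along the long edge\<close>

text \<open>
  The situation after the translation of \<open>P\<close> to the origin: \<open>u\<close> is the direction of the edge through
  the origin, so the cell dual to this edge lies in the single row of height \<open>y0\<close>.
\<close>

locale thick_origin = tropical_polynomial A c for A c +
  fixes m :: nat and u :: "int \<times> int" and y0 :: real
  assumes prim: "primitive u"
    and on_curve: "card (maximizers A c 0) \<ge> 2"
    and origin_row: "\<And>a. a \<in> maximizers A c 0 \<Longrightarrow> of_lattice u \<bullet> of_lattice a = y0"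
    and wide: "\<exists>a\<in>A. \<exists>b\<in>A. of_lattice u \<bullet> (of_lattice a - of_lattice b) \<ge> real m"
    and thick_sections: "\<And>\<mu>. thick m (newton_section A c \<mu>)"
begin

abbreviation height :: "real \<times> real \<Rightarrow> real" where
  "height x \<equiv> of_lattice u \<bullet> x"

abbreviation on_line :: "real \<Rightarrow> real \<times> real" where
  "on_line t \<equiv> t *\<^sub>R of_lattice u"

abbreviation top_level :: real where
  "top_level \<equiv> trop_poly A c 0"

definition row_length_ge :: "real \<Rightarrow> real \<Rightarrow> real \<Rightarrow> bool" where
  "row_length_ge s t y \<longleftrightarrow> (\<exists>x r. x \<in> dual_cell A c (on_line t) \<and>
     x + r *\<^sub>R of_lattice (rot u) \<in> dual_cell A c (on_line t) \<and> height x = y \<and> r \<ge> s)"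

lemma height_rot [simp]: "height (x + r *\<^sub>R of_lattice (rot u)) = height x"
  by (simp add: inner_add_right of_lattice_def rot_def inner_prod_def algebra_simps)

lemma height_dual_cell_origin:
  assumes "x \<in> dual_cell A c 0"
  shows "height x = y0"
proof -
  have "dual_cell A c 0 \<subseteq> {x. height x = y0}"
    unfolding dual_cell_def
    by (rule hull_minimal) (auto simp: origin_row convex_hyperplane)
  with assms show ?thesis by blast
qed

lemma two_maximizers_at_origin:
  obtains a b where "a \<in> maximizers A c 0" "b \<in> maximizers A c 0" "a \<noteq> b"
  using on_curve by (meson card_2_iff' obtain_subset_with_card_n subsetD)

lemma maximizer_at_origin:
  assumes "a \<in> maximizers A c 0"
  shows "(of_lattice a, top_level) \<in> N" "height (of_lattice a) = y0" "c a = top_level" "a \<in> A"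
  using assms of_lattice_in_ext_newton[of a A top_level c] origin_row by (auto simp: maximizers_iff)

lemma level_less_top:
  assumes "(x, \<mu>) \<in> N" "height x \<noteq> y0"
  shows "\<mu> < top_level"
  using ext_newton_support[OF assms(1), of 0] height_dual_cell_origin[of x] assms(2) by auto

text \<open>
  The lift of \<open>d(0)\<close>, at height \<open>y0\<close>, is strictly higher than \<open>\<mu>\<close>, yet it stays below the line of
  slope \<open>-t\<close> supporting the polyhedron over \<open>x\<close>. So this line falls in the direction from \<open>y0\<close> to
  the height of \<open>x\<close>, and beyond \<open>x\<close> nothing reaches the level \<open>\<mu>\<close>: \<open>x\<close> lies in an extreme row of
  the section.
\<close>

lemma level_set_extreme:
  assumes "(x, \<mu>) \<in> N" "x \<in> dual_cell A c (on_line t)" "\<mu> = trop_poly A c (on_line t) - t * height x"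
    and "height x \<noteq> y0" "(x', \<mu>) \<in> N"
  shows "y0 < height x \<Longrightarrow> height x' \<le> height x" "height x < y0 \<Longrightarrow> height x \<le> height x'"
proof -
  obtain p where p: "p \<in> maximizers A c 0" using maximizers_nonempty by blast
  have lt: "\<mu> < top_level" using level_less_top assms by blast
  have up: "t * height x' + \<mu> \<le> trop_poly A c (on_line t)"
    using ext_newton_le[OF assms(5), of "on_line t"] by (simp add: inner_commute)
  have P: "t * y0 + top_level \<le> trop_poly A c (on_line t)"
    using ext_newton_le[OF maximizer_at_origin(1)[OF p], of "on_line t"] maximizer_at_origin(2)[OF p]
    by (simp add: inner_commute)
  have "t * (height x' - height x) \<le> 0" using up assms(3) by (simp add: algebra_simps)
  moreover have "t * (y0 - height x) < 0" using P assms(3) lt by (simp add: algebra_simps)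
  ultimately show "y0 < height x \<Longrightarrow> height x' \<le> height x" "height x < y0 \<Longrightarrow> height x \<le> height x'"
    by (auto simp: mult_le_0_iff mult_less_0_iff)
qed

lemma aff_dim_2_if_two_rows:
  assumes "x \<in> S" "x + r *\<^sub>R of_lattice (rot u) \<in> S" "r \<noteq> 0" "z \<in> S" "height z \<noteq> height x"
  shows "aff_dim S = 2"
proof -
  have "\<not> collinear S"
  proof
    assume "collinear S"
    then obtain w where w: "\<And>x y. x \<in> S \<Longrightarrow> y \<in> S \<Longrightarrow> \<exists>k. x - y = k *\<^sub>R w"
      unfolding collinear_def by blast
    obtain k where "x + r *\<^sub>R of_lattice (rot u) - x = k *\<^sub>R w" using w[OF assms(2,1)] by blast
    then have k: "r *\<^sub>R of_lattice (rot u) = k *\<^sub>R w" by simp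
    have "rot u \<noteq> 0 \<and> of_lattice (rot u) \<noteq> 0"
      using of_lattice_nonzero[OF primitive_rot[OF prim]] by (auto simp: of_lattice_def zero_prod_def)
    with k assms(3) have "k \<noteq> 0" by (metis scaleR_eq_0_iff)
    moreover have "height (r *\<^sub>R of_lattice (rot u)) = 0" using height_rot[of 0 r] by simp
    ultimately have "height w = 0" using k by simp
    moreover obtain k' where "z - x = k' *\<^sub>R w" using w[OF assms(4,1)] by blast
    then have "height (z - x) = k' * height w" by simp
    ultimately show False using assms(5) by (simp add: inner_diff_right)
  qed
  then have "aff_dim S > 1" by (simp add: collinear_aff_dim)
  moreover have "aff_dim S \<le> 2" using aff_dim_le_DIM[of S] by simp
  ultimately show ?thesis by simp
qed

text \<open>
  The heart of the argument. The level \<open>\<mu>\<close> of a point \<open>x\<close> of \<open>d(t u)\<close> exceeds the critical level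
  \<open>\<mu>'\<close>, so the section at \<open>\<mu>\<close> has width at most \<open>m - s\<close> and thickness gives two sides of length at
  least \<open>s\<close>. These are its two extreme rows, one of which is the row of \<open>x\<close>; and all points of
  this row lie in the same dual cell as \<open>x\<close>.
\<close>

lemma long_row:
  assumes narrow: "\<And>\<mu> x z. \<mu> > \<mu>' \<Longrightarrow> (x, \<mu>) \<in> N \<Longrightarrow> (z, \<mu>) \<in> N \<Longrightarrow> height (x - z) < real m - s"
    and "s > 0"
    and "x \<in> dual_cell A c (on_line t)" "height x \<noteq> y0"
    and high: "(x', \<nu>) \<in> N" "\<nu> > \<mu>'" "height x' = height x"
  shows "row_length_ge s t (height x)"
proof -
  define \<mu> where "\<mu> = trop_poly A c (on_line t) - t * height x"
  have x: "(x, \<mu>) \<in> N" using dual_cell_lift[OF assms(3)] by (simp add: \<mu>_def inner_commute)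
  have "\<nu> \<le> \<mu>" using ext_newton_le[OF high(1), of "on_line t"] high(3) by (simp add: \<mu>_def inner_commute)
  then have "\<mu> > \<mu>'" using high by simp
  define K where "K = newton_section A c \<mu>"
  have K: "z \<in> K \<longleftrightarrow> (z, \<mu>) \<in> N" for z by (simp add: K_def newton_section_def)
  have "convex K" "compact K"
    using convex_newton_section compact_newton_section finite_support by (simp_all add: K_def)
  then have hull: "convex hull K = K" by (simp add: convex_hull_eq)
  have lt: "\<mu> < top_level" using level_less_top x assms by blast
  have "K \<noteq> {}" using x K by blast
  obtain a b where ab: "a \<in> maximizers A c 0" "b \<in> maximizers A c 0" "a \<noteq> b"
    by (rule two_maximizers_at_origin)
  have abK: "of_lattice a \<in> K" "of_lattice b \<in> K"
    using maximizer_at_origin(1)[OF ab(1)] maximizer_at_origin(1)[OF ab(2)] lt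
    by (auto simp: K intro: ext_newton_downward)
  have "height (of_lattice b - of_lattice a) = 0"
    using maximizer_at_origin(2) ab by (simp add: inner_diff_right)
  then obtain r where r: "of_lattice b - of_lattice a = r *\<^sub>R of_lattice (rot u)"
    using orthogonal_imp_multiple_rot[OF prim] by metis
  then have r': "of_lattice a + r *\<^sub>R of_lattice (rot u) = of_lattice b" by (simp add: algebra_simps)
  have "of_lattice b \<noteq> of_lattice a" using ab(3) injD[OF inj_of_lattice] by metis
  then have "r \<noteq> 0" using r by auto
  have dim: "aff_dim K = 2"
    by (rule aff_dim_2_if_two_rows[of "of_lattice a" K r x])
       (use abK r' \<open>r \<noteq> 0\<close> x K assms(4) maximizer_at_origin(2)[OF ab(1)] in auto)
  \<comment> \<open>The lattice length guaranteed by thickness is the defect \<open>m - w\<close>, and \<open>s \<le> m - w\<close>.\<close>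
  define w where "w = width_dir u K"
  have "w \<le> real m - s"
    unfolding w_def width_dir_def
  proof (rule cSup_least)
    show "{height (x - y) |x y. x \<in> K \<and> y \<in> K} \<noteq> {}" using \<open>K \<noteq> {}\<close> by blast
  next
    fix h assume "h \<in> {height (x - y) |x y. x \<in> K \<and> y \<in> K}"
    then obtain x y where "h = height (x - y)" "x \<in> K" "y \<in> K" by blast
    then show "h \<le> real m - s" using narrow[OF \<open>\<mu> > \<mu>'\<close>, of x y] by (simp add: K)
  qed
  then have w: "real m - w > 0" "w = real m - (real m - w)" and s_le: "s \<le> real m - w" using \<open>s > 0\<close> by auto
  have "thick m K" using thick_sections by (simp add: K_def)
  then have "\<forall>u a. primitive u \<and> a > 0 \<and> width_dir u K = real m - a \<longrightarrow>
      (\<exists>S T. S \<noteq> T \<and> S facet_of K \<and> perpendicular_to S u \<and> lattice_length S \<ge> a \<and>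
           T facet_of K \<and> perpendicular_to T u \<and> lattice_length T \<ge> a)"
    unfolding thick_def hull using dim \<open>K \<noteq> {}\<close> by simp
  then have "\<exists>S T. S \<noteq> T \<and> S facet_of K \<and> perpendicular_to S u \<and> lattice_length S \<ge> real m - w \<and>
           T facet_of K \<and> perpendicular_to T u \<and> lattice_length T \<ge> real m - w"
    using prim w w_def by blast
  then obtain S T where ST: "S \<noteq> T" "S facet_of K" "perpendicular_to S u"
    "lattice_length S \<ge> real m - w" "T facet_of K" "perpendicular_to T u" "lattice_length T \<ge> real m - w"
    by blast
  obtain k1 where k1: "S = K \<inter> {x. height x = k1}"
    "(\<forall>x\<in>K. height x \<le> k1) \<or> (\<forall>x\<in>K. k1 \<le> height x)"
    using facet_perpendicular_extreme[OF prim \<open>convex K\<close> dim ST(2,3)] by metis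
  obtain k2 where k2: "T = K \<inter> {x. height x = k2}"
    "(\<forall>x\<in>K. height x \<le> k2) \<or> (\<forall>x\<in>K. k2 \<le> height x)"
    using facet_perpendicular_extreme[OF prim \<open>convex K\<close> dim ST(5,6)] by metis
  have "k1 \<noteq> k2" using ST(1) k1 k2 by blast
  have "S \<noteq> {}" "T \<noteq> {}" using ST by (auto simp: facet_of_def)
  then obtain p q where pq: "p \<in> K" "height p = k1" "q \<in> K" "height q = k2" using k1 k2 by blast
  have ext: "y0 < height x \<Longrightarrow> height z \<le> height x" "height x < y0 \<Longrightarrow> height x \<le> height z" if "z \<in> K" for z
    using level_set_extreme[OF x assms(3) \<mu>_def assms(4)] that by (auto simp: K)
  have "height x = k1 \<or> height x = k2"
  proof (cases "y0 < height x")
    case True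
    have "x \<in> K" using x K by blast
    then show ?thesis using ext(1)[OF _ True] pq k1(2) k2(2) \<open>k1 \<noteq> k2\<close> by (metis order_antisym)
  next
    case False
    then have "height x < y0" using assms(4) by simp
    moreover have "x \<in> K" using x K by blast
    ultimately show ?thesis using ext(2) pq k1(2) k2(2) \<open>k1 \<noteq> k2\<close> by (metis order_antisym)
  qed
  define R where "R = K \<inter> {z. height z = height x}"
  have "R = S \<or> R = T" using \<open>height x = k1 \<or> height x = k2\<close> k1(1) k2(1) by (auto simp: R_def)
  then have R: "perpendicular_to R u" "lattice_length R \<ge> s" using ST s_le by auto
  have "compact R" unfolding R_def by (intro compact_Int_closed \<open>compact K\<close> closed_hyperplane)
  then obtain z r where z: "z \<in> R" "z + r *\<^sub>R of_lattice (rot u) \<in> R" "r \<ge> s"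
    using long_segment_of_lattice_length[OF prim _ R \<open>s > 0\<close>] by metis
  \<comment> \<open>Height and level determine the value of the supporting functional, so it is maximal on all of \<open>R\<close>.\<close>
  have "R \<subseteq> dual_cell A c (on_line t)"
  proof
    fix z assume "z \<in> R"
    then have "(z, \<mu>) \<in> N" "z \<bullet> on_line t + \<mu> = trop_poly A c (on_line t)"
      using K by (auto simp: R_def \<mu>_def inner_commute)
    then show "z \<in> dual_cell A c (on_line t)"
      using ext_newton_support[of z \<mu> "on_line t"] by simp
  qed
  then show ?thesis unfolding row_length_ge_def using z R_def by blast
qed

lemma ext_newton_combine:
  assumes "(x, \<mu>) \<in> N" "(z, \<nu>) \<in> N" "0 \<le> \<theta>" "\<theta> \<le> 1"
  shows "((1 - \<theta>) *\<^sub>R x + \<theta> *\<^sub>R z, (1 - \<theta>) * \<mu> + \<theta> * \<nu>) \<in> N"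
  using convexD[OF convex_ext_newton_polyhedron assms(1,2), of "1 - \<theta>" \<theta>] assms(3,4) by simp

text \<open>
  A concave function has a supporting line over each interior point. The row maximum \<open>\<nu>\<close> at height
  \<open>y\<close> is attained by compactness, and \<open>t\<close> is the largest of the slopes forced by the monomials
  below \<open>y\<close>; it respects a monomial above \<open>y\<close> because the segment joining that monomial with the
  one that determines \<open>t\<close> crosses height \<open>y\<close> at level at most \<open>\<nu>\<close>.
\<close>

lemma dual_cell_at_height:
  assumes "a \<in> A" "b \<in> A" "height (of_lattice b) < y" "y < height (of_lattice a)"
  obtains t x where "x \<in> dual_cell A c (on_line t)" "height x = y"
proof -
  define h where "h a = height (of_lattice a)" for a
  define L where "L = lifted_polytope A c \<inter> {p. height (fst p) = y}"
  have in_L: "((1 - \<theta>) *\<^sub>R of_lattice b' + \<theta> *\<^sub>R of_lattice a', (1 - \<theta>) * c b' + \<theta> * c a') \<in> L"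
    if "a' \<in> A" "b' \<in> A" "h b' < y" "y < h a'" "\<theta> = (y - h b') / (h a' - h b')" for a' b' \<theta>
  proof -
    have pos: "h a' - h b' > 0" using that by linarith
    have \<theta>: "0 \<le> \<theta>" "\<theta> \<le> 1" "\<theta> * (h a' - h b') = y - h b'"
      unfolding that(5) using that(3,4) pos by (simp_all add: divide_le_eq)
    have "(1 - \<theta>) *\<^sub>R (of_lattice b', c b') + \<theta> *\<^sub>R (of_lattice a', c a') \<in> lifted_polytope A c"
      unfolding lifted_polytope_def using that \<theta> by (intro convexD) (auto intro: hull_inc)
    moreover have "(1 - \<theta>) * h b' + \<theta> * h a' = y" using \<theta>(3) by (simp add: algebra_simps)
    ultimately show ?thesis by (simp add: L_def inner_add_right h_def)
  qed
  have "L \<noteq> {}" using in_L[of a b] assms by (auto simp: h_def)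
  moreover have "compact L"
    unfolding L_def
    by (intro compact_Int_closed compact_lifted_polytope finite_support closed_Collect_eq continuous_intros)
  moreover have "continuous_on L snd" by (intro continuous_intros)
  ultimately obtain p where p: "p \<in> L" "\<And>q. q \<in> L \<Longrightarrow> snd q \<le> snd p"
    using continuous_attains_sup[of L snd] by blast
  obtain x \<nu> where x\<nu>: "p = (x, \<nu>)" by (metis surj_pair)
  have x: "(x, \<nu>) \<in> N" "height x = y"
    using p(1) x\<nu> ext_newton_iff_below_lifted[of x \<nu> A c] by (auto simp: L_def)
  define F where "F = {b \<in> A. h b < y}"
  define slope where "slope b = (c b - \<nu>) / (y - h b)" for b
  define t where "t = Max (slope ` F)"
  have "finite F" "b \<in> F" using finite_support assms by (simp_all add: F_def h_def)
  then have F: "finite (slope ` F)" "slope ` F \<noteq> {}" by blast+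
  have below: "t * h a' + c a' \<le> t * y + \<nu>" if "a' \<in> A" for a'
  proof -
    consider "h a' < y" | "h a' = y" | "h a' > y" by linarith
    then show ?thesis
    proof cases
      case 1
      then have "slope a' \<le> t" unfolding t_def using F that by (auto simp: F_def)
      then show ?thesis using 1 by (simp add: slope_def field_simps)
    next
      case 2
      then have "(of_lattice a', c a') \<in> L"
        using that by (auto simp: L_def lifted_polytope_def h_def intro: hull_inc)
      then have "c a' \<le> \<nu>" using p(2) x\<nu> by (metis snd_conv)
      then show ?thesis using 2 by simp
    next
      case 3
      have "t \<in> slope ` F" unfolding t_def using F by (rule Max_in)
      then obtain b' where b': "t = slope b'" "b' \<in> A" "h b' < y" by (auto simp: F_def)
      define \<theta> where "\<theta> = (y - h b') / (h a' - h b')"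
      have pos: "h a' - h b' > 0" "y - h b' > 0" using b' 3 by simp_all
      have "(1 - \<theta>) * c b' + \<theta> * c a' \<le> \<nu>"
        using p(2)[OF in_L[OF that b'(2,3) 3 \<theta>_def]] x\<nu> by simp
      then have "((1 - \<theta>) * c b' + \<theta> * c a') * (h a' - h b') \<le> \<nu> * (h a' - h b')"
        using pos by (intro mult_right_mono) auto
      moreover have "\<theta> * (h a' - h b') = y - h b'" using pos by (simp add: \<theta>_def)
      moreover have "((1 - \<theta>) * c b' + \<theta> * c a') * (h a' - h b') =
          c b' * ((h a' - h b') - \<theta> * (h a' - h b')) + c a' * (\<theta> * (h a' - h b'))"
        by (simp add: algebra_simps)
      ultimately have "c b' * (h a' - y) + c a' * (y - h b') \<le> \<nu> * (h a' - h b')" by simp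
      then have "(c b' - \<nu>) * (h a' - y) \<le> (\<nu> - c a') * (y - h b')" by (simp add: algebra_simps)
      then have "t * (h a' - y) \<le> \<nu> - c a'" using pos by (simp add: b'(1) slope_def field_simps)
      then show ?thesis by (simp add: algebra_simps)
    qed
  qed
  obtain a' where a': "a' \<in> maximizers A c (on_line t)" using maximizers_nonempty by blast
  have "trop_poly A c (on_line t) \<le> t * y + \<nu>"
    using below[of a'] a' by (simp add: maximizers_iff h_def inner_commute)
  then have "x \<in> dual_cell A c (on_line t)"
    using ext_newton_support[OF x(1), of "on_line t"] x(2) by (simp add: inner_commute)
  with x(2) show thesis by (intro that)
qed

text \<open>
  The highest level at which the section still contains two points whose heights differ by \<open>m - s\<close>.
  Maximizing the minimum of two independent levels over the compact lifted polytope avoids having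
  to choose both points on one level; the polyhedron is closed under lowering a level. At the top
  level there is only the row \<open>y0\<close>, so the critical level is strictly lower.
\<close>

lemma critical_level:
  assumes "0 < s" "s < real m"
  obtains \<mu>' x z where "(x, \<mu>') \<in> N" "(z, \<mu>') \<in> N" "height (x - z) \<ge> real m - s" "\<mu>' < top_level"
    and "\<And>\<mu> x z. \<mu> > \<mu>' \<Longrightarrow> (x, \<mu>) \<in> N \<Longrightarrow> (z, \<mu>) \<in> N \<Longrightarrow> height (x - z) < real m - s"
proof -
  define L where "L = lifted_polytope A c"
  define B where "B = (L \<times> L) \<inter> {p. real m - s \<le> height (fst (fst p) - fst (snd p))}"
  define f where "f p = min (snd (fst p)) (snd (snd p))" for p :: "((real \<times> real) \<times> real) \<times> ((real \<times> real) \<times> real)"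
  have "compact B"
    unfolding B_def L_def
    by (intro compact_Int_closed compact_Times compact_lifted_polytope finite_support
         closed_Collect_le continuous_intros)
  moreover have "B \<noteq> {}"
  proof -
    obtain a b where ab: "a \<in> A" "b \<in> A" "height (of_lattice a - of_lattice b) \<ge> real m" using wide by blast
    then have "((of_lattice a, c a), (of_lattice b, c b)) \<in> B"
      using assms by (auto simp: B_def L_def lifted_polytope_def intro: hull_inc)
    then show ?thesis by blast
  qed
  moreover have "continuous_on B f" unfolding f_def by (intro continuous_intros)
  ultimately obtain p where p: "p \<in> B" "\<And>q. q \<in> B \<Longrightarrow> f q \<le> f p"
    using continuous_attains_sup[of B f] by metis
  obtain x \<mu>1 z \<mu>2 where eq: "p = ((x, \<mu>1), (z, \<mu>2))" by (metis surj_pair)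
  define \<mu>' where "\<mu>' = f p"
  have xz: "(x, \<mu>') \<in> N" "(z, \<mu>') \<in> N" "height (x - z) \<ge> real m - s"
  proof -
    have "(x, \<mu>1) \<in> L" "(z, \<mu>2) \<in> L" "\<mu>' = min \<mu>1 \<mu>2"
      using p(1) by (simp_all add: eq B_def \<mu>'_def f_def)
    then show "(x, \<mu>') \<in> N" "(z, \<mu>') \<in> N"
      unfolding L_def ext_newton_iff_below_lifted by (metis min.cobounded1 min.cobounded2)+
    show "height (x - z) \<ge> real m - s" using p(1) by (simp add: eq B_def)
  qed
  moreover have "\<mu>' < top_level"
  proof (rule ccontr)
    assume "\<not> \<mu>' < top_level"
    then have "height x = y0" "height z = y0" using level_less_top xz by blast+
    then show False using xz(3) assms by (simp add: inner_diff_right)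
  qed
  moreover have "height (x - z) < real m - s" if lev: "\<mu> > \<mu>'" "(x, \<mu>) \<in> N" "(z, \<mu>) \<in> N" for \<mu> x z
  proof (rule ccontr)
    assume "\<not> ?thesis"
    moreover obtain \<nu>1 \<nu>2 where "\<nu>1 \<ge> \<mu>" "(x, \<nu>1) \<in> L" "\<nu>2 \<ge> \<mu>" "(z, \<nu>2) \<in> L"
      using lev(2,3) unfolding L_def ext_newton_iff_below_lifted by blast
    ultimately have "((x, \<nu>1), (z, \<nu>2)) \<in> B" "f ((x, \<nu>1), (z, \<nu>2)) \<ge> \<mu>"
      by (auto simp: B_def f_def)
    then show False using p(2)[of "((x, \<nu>1), (z, \<nu>2))"] \<open>\<mu> > \<mu>'\<close> by (simp add: \<mu>'_def)
  qed
  ultimately show thesis by (rule that)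
qed

lemma ext_newton_over_polygon:
  assumes "(x, \<mu>) \<in> N"
  shows "x \<in> newton_polygon A"
proof -
  have "N \<subseteq> newton_polygon A \<times> UNIV"
    unfolding ext_newton_polyhedron_def newton_polygon_def
    by (rule hull_minimal) (auto intro: hull_inc convex_Times)
  with assms show ?thesis by blast
qed

text \<open>
  The vertices of dual cells are lattice points, so a cell that meets a non-integral height cannot
  be confined to one row.
\<close>

lemma lattice_height_in_Ints: "height (of_lattice a) \<in> \<int>"
  by (simp add: of_lattice_def inner_prod_def)

text \<open>
  The interval of heights spanned by two extremal points at the critical level. Every height inside
  it is reached strictly above the critical level, on a segment towards the lift of \<open>d(P)\<close>, so the
  bound on row lengths applies there. The last conjunct places the segment from the origin to
  \<open>t u\<close> on the curve.
\<close>

lemma long_rows_on_long_edge: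
  assumes s: "0 < s" "s < real m"
  shows "\<exists>\<alpha> \<beta>. real m - s \<le> \<beta> - \<alpha> \<and> (\<forall>y. \<alpha> < y \<and> y < \<beta> \<and> y \<notin> \<int> \<longrightarrow>
    (\<exists>t. row_length_ge s t y \<and> aff_dim (dual_cell A c (on_line t)) = 2 \<and>
      (\<forall>\<theta>\<in>{0..1}. card (maximizers A c (on_line (\<theta> * t))) \<ge> 2)))"
proof (rule critical_level[OF s])
  fix \<mu>' x z
  assume xz: "(x, \<mu>') \<in> N" "(z, \<mu>') \<in> N" "height (x - z) \<ge> real m - s" "\<mu>' < top_level"
    and narrow: "\<And>\<mu> x z. \<mu> > \<mu>' \<Longrightarrow> (x, \<mu>) \<in> N \<Longrightarrow> (z, \<mu>) \<in> N \<Longrightarrow> height (x - z) < real m - s"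
  \<comment> \<open>The heights reached strictly above the critical level.\<close>
  define G where "G = (\<lambda>p. height (fst p)) ` (N \<inter> {p. \<mu>' < snd p})"
  obtain e where e: "e \<in> maximizers A c 0" using maximizers_nonempty by blast
  have G: "y \<in> G \<longleftrightarrow> (\<exists>x \<mu>. (x, \<mu>) \<in> N \<and> \<mu> > \<mu>' \<and> height x = y)" for y
    by (force simp: G_def)
  have "convex G"
    unfolding G_def
  proof (rule convex_linear_image)
    show "linear (\<lambda>p. height (fst p))" by (intro linearI) (simp_all add: inner_add_right)
    have "{p. \<mu>' < snd p} = {p. \<mu>' < inner (0, 1) p}" for \<mu>' :: real
      by (auto simp: inner_prod_def)
    then show "convex (N \<inter> {p. \<mu>' < snd p})"
      by (metis convex_Int convex_ext_newton_polyhedron convex_halfspace_gt)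
  qed
  have "y0 \<in> G" using maximizer_at_origin[OF e] xz(4) unfolding G by blast
  have towards_y0: "y \<in> G"
    if "(w, \<mu>') \<in> N" "height w < y \<and> y \<le> y0 \<or> y0 \<le> y \<and> y < height w" for w y
  proof -
    define \<theta> where "\<theta> = (y - height w) / (y0 - height w)"
    have \<theta>: "0 < \<theta>" "\<theta> \<le> 1" "\<theta> * (y0 - height w) = y - height w"
      using that(2) by (auto simp: \<theta>_def field_simps)
    have "((1 - \<theta>) *\<^sub>R w + \<theta> *\<^sub>R of_lattice e, (1 - \<theta>) * \<mu>' + \<theta> * top_level) \<in> N"
      using \<theta> by (intro ext_newton_combine that(1) maximizer_at_origin[OF e]) auto
    moreover have "height ((1 - \<theta>) *\<^sub>R w + \<theta> *\<^sub>R of_lattice e) = y"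
      using \<theta>(3) by (simp add: inner_add_right maximizer_at_origin(2)[OF e] algebra_simps)
    moreover have "(1 - \<theta>) * \<mu>' + \<theta> * top_level > \<mu>'"
      using mult_strict_left_mono[OF xz(4) \<theta>(1)] by (simp add: algebra_simps)
    ultimately show ?thesis unfolding G by blast
  qed
  have long: "row_length_ge s t (height w)" if "w \<in> dual_cell A c (on_line t)" "height w \<noteq> y0" "height w \<in> G" for w t
    using that(3) long_row[of \<mu>' s w t] narrow s that unfolding G by metis
  have two: "card (maximizers A c (on_line t)) \<ge> 2" if row: "row_length_ge s t y" for t y
  proof (rule ccontr)
    assume "\<not> ?thesis"
    then have "card (maximizers A c (on_line t)) = 1"
      using maximizers_nonempty[of "on_line t"] finite_maximizers[of "on_line t"]
      by (metis One_nat_def Suc_1 card_0_eq less_2_cases not_le)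
    then obtain a where a: "maximizers A c (on_line t) = {a}" by (auto simp: card_1_singleton_iff)
    have "dual_cell A c (on_line t) = {of_lattice a}" by (simp add: dual_cell_def a)
    then obtain x r where "x = of_lattice a" "x + r *\<^sub>R of_lattice (rot u) = of_lattice a" "r \<ge> s"
      using row unfolding row_length_ge_def by blast
    then have "r *\<^sub>R of_lattice (rot u) = 0" "r \<noteq> 0" using s by auto
    then show False using of_lattice_nonzero[OF primitive_rot[OF prim]] by simp
  qed
  have "real m - s \<le> height x - height z" using xz(3) by (simp add: inner_diff_right)
  moreover have "\<exists>t. row_length_ge s t y \<and> aff_dim (dual_cell A c (on_line t)) = 2 \<and>
      (\<forall>\<theta>\<in>{0..1}. card (maximizers A c (on_line (\<theta> * t))) \<ge> 2)"
    if y: "height z < y" "y < height x" "y \<notin> \<int>" for y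
  proof -
    have "y \<in> G" using towards_y0[of z y] towards_y0[of x y] xz(1,2) y by linarith
    have "y \<noteq> y0" using y(3) lattice_height_in_Ints[of e] maximizer_at_origin(2)[OF e] by auto
    have ends: "\<exists>a\<in>A. y < height (of_lattice a)" "\<exists>b\<in>A. height (of_lattice b) < y"
    proof -
      show "\<exists>a\<in>A. y < height (of_lattice a)"
      proof (rule ccontr)
        assume "\<not> ?thesis"
        then have "newton_polygon A \<subseteq> {w. height w \<le> y}"
          unfolding newton_polygon_def
          by (intro hull_minimal) (auto simp: convex_halfspace_le not_less)
        then show False using ext_newton_over_polygon[OF xz(1)] y(2) by force
      qed
      show "\<exists>b\<in>A. height (of_lattice b) < y"
      proof (rule ccontr)
        assume "\<not> ?thesis"
        then have "newton_polygon A \<subseteq> {w. height w \<ge> y}"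
          unfolding newton_polygon_def
          by (intro hull_minimal) (auto simp: convex_halfspace_ge not_less)
        then show False using ext_newton_over_polygon[OF xz(2)] y(1) by force
      qed
    qed
    then obtain t w where w: "w \<in> dual_cell A c (on_line t)" "height w = y"
      using dual_cell_at_height by metis
    have row: "row_length_ge s t y" using long w \<open>y \<in> G\<close> \<open>y \<noteq> y0\<close> by metis
    obtain v r where v: "v \<in> dual_cell A c (on_line t)"
      "v + r *\<^sub>R of_lattice (rot u) \<in> dual_cell A c (on_line t)" "height v = y" "r \<ge> s"
      using row unfolding row_length_ge_def by blast
    obtain a where a: "a \<in> maximizers A c (on_line t)" using maximizers_nonempty by blast
    have "aff_dim (dual_cell A c (on_line t)) = 2"
    proof (rule aff_dim_2_if_two_rows[OF v(1,2)])
      show "r \<noteq> 0" using v s by auto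
      show "of_lattice a \<in> dual_cell A c (on_line t)" using a by (auto simp: dual_cell_def intro: hull_inc)
      show "height (of_lattice a) \<noteq> height v" using v y(3) lattice_height_in_Ints by metis
    qed
    moreover have "card (maximizers A c (on_line (\<theta> * t))) \<ge> 2" if \<theta>: "\<theta> \<in> {0..1}" for \<theta>
    proof -
      consider "\<theta> * t = 0" | "\<theta> = 1" | "t \<noteq> 0" "0 < \<theta>" "\<theta> < 1" using \<theta> by force
      then show ?thesis
      proof cases
        case 1
        then have "on_line (\<theta> * t) = 0" by (simp only: scale_zero_left)
        then show ?thesis using on_curve by (simp only:)
      next
        case 2
        then show ?thesis using two[OF row] by simp
      next
        case 3
        obtain a where a: "a \<in> maximizers A c (on_line (\<theta> * t))" using maximizers_nonempty by blast
        define y' where "y' = height (of_lattice a)"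
        define g where "g t = trop_poly A c (on_line t)" for t
        have ga: "\<theta> * t * y' + c a = g (\<theta> * t)" "a \<in> A"
          using a by (auto simp: maximizers_iff g_def y'_def inner_commute)
        have 1: "c a + t * y' \<le> g t"
          using monomial_le_trop_poly[OF ga(2), of "on_line t"] by (simp add: g_def y'_def inner_commute)
        have 2: "c a \<le> top_level" using monomial_le_trop_poly[OF ga(2), of 0] by simp
        have 3: "\<theta> * t * y0 + top_level \<le> g (\<theta> * t)"
          using ext_newton_le[OF maximizer_at_origin(1)[OF e], of "on_line (\<theta> * t)"]
            maximizer_at_origin(2)[OF e] by (simp add: g_def inner_commute)
        have 4: "\<theta> * t * y + (g t - t * y) \<le> g (\<theta> * t)"
          using ext_newton_le[OF dual_cell_lift[OF w(1)], of "on_line (\<theta> * t)"] w(2)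
          by (simp add: g_def inner_commute)
        \<comment> \<open>The heights of the cells \<open>d(t u)\<close> depend monotonically on \<open>t\<close>, so \<open>y'\<close> is between \<open>y0\<close> and \<open>y\<close>.\<close>
        have "\<theta> * t * (y' - y0) \<ge> 0" using ga 2 3 by (simp add: algebra_simps)
        moreover have "(1 - \<theta>) * t * (y - y') \<ge> 0" using ga 1 4 by (simp add: algebra_simps)
        ultimately have "t * (y' - y0) \<ge> 0" "t * (y - y') \<ge> 0"
          using \<open>0 < \<theta>\<close> \<open>\<theta> < 1\<close> by (auto simp: zero_le_mult_iff mult.assoc)
        then have "y' \<in> closed_segment y0 y"
          using \<open>t \<noteq> 0\<close> by (auto simp: zero_le_mult_iff closed_segment_eq_real_ivl)
        then have "y' \<in> G"
          using \<open>convex G\<close> \<open>y0 \<in> G\<close> \<open>y \<in> G\<close> closed_segment_subset by blast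
        show ?thesis
        proof (cases "y' = y0")
          case True
          have "c a = top_level" using True ga 2 3 by simp
          then have eq: "g (\<theta> * t) = \<theta> * t * y0 + top_level" using ga True by simp
          have "maximizers A c 0 \<subseteq> maximizers A c (on_line (\<theta> * t))"
          proof
            fix b assume "b \<in> maximizers A c 0"
            note maximizer_at_origin(2-4)[OF this]
            then show "b \<in> maximizers A c (on_line (\<theta> * t))"
              using eq by (simp add: maximizers_iff g_def inner_commute)
          qed
          then show ?thesis using on_curve card_mono[OF finite_maximizers] by (meson order_trans)
        next
          case False
          have "of_lattice a \<in> dual_cell A c (on_line (\<theta> * t))"
            using a by (auto simp: dual_cell_def intro: hull_inc)
          then have "row_length_ge s (\<theta> * t) y'" using long False \<open>y' \<in> G\<close> unfolding y'_def by blast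
          then show ?thesis by (rule two)
        qed
      qed
    qed
    ultimately show "\<exists>t. row_length_ge s t y \<and> aff_dim (dual_cell A c (on_line t)) = 2 \<and>
      (\<forall>\<theta>\<in>{0..1}. card (maximizers A c (on_line (\<theta> * t))) \<ge> 2)"
      using row by blast
  qed
  ultimately show ?thesis by blast
qed

end

section \<open>Area from lengths of rows\<close>

text \<open>
  Layer-cake formula: \<open>\<integral>\<rho>\<close> is the integral over \<open>s\<close> of the measures of the superlevel sets
  \<open>{y. s \<le> \<rho> y}\<close>, and the lower bounds \<open>m - s\<close> for these integrate to the area of a triangle.
\<close>

lemma nn_integral_ge_triangle:
  fixes \<rho> :: "real \<Rightarrow> ennreal" and m :: real
  assumes [measurable]: "\<rho> \<in> borel_measurable borel" and "m > 0"
    and level: "\<And>s. 0 < s \<Longrightarrow> s < m \<Longrightarrow> ennreal (m - s) \<le> emeasure lborel {y. ennreal s \<le> \<rho> y}"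
  shows "ennreal (m\<^sup>2 / 2) \<le> (\<integral>\<^sup>+y. \<rho> y \<partial>lborel)"
proof -
  define G where "G y s = (indicator {0..m} s * (if ennreal s \<le> \<rho> y then 1 else 0) :: ennreal)" for y s :: real
  have [measurable]: "case_prod G \<in> borel_measurable (borel \<Otimes>\<^sub>M borel)"
    unfolding G_def by measurable
  have "((\<lambda>s. m * s - s\<^sup>2 / 2) has_real_derivative (m - s)) (at s)" for s
    by (auto intro!: derivative_eq_intros)
  then have "(\<integral>\<^sup>+s. ennreal (m - s) * indicator {0..m} s \<partial>lborel)
      = ennreal ((m * m - m\<^sup>2 / 2) - (m * 0 - 0\<^sup>2 / 2))"
    using \<open>m > 0\<close> by (intro nn_integral_FTC_Icc) auto
  also have "(m * m - m\<^sup>2 / 2) - (m * 0 - 0\<^sup>2 / 2) = m\<^sup>2 / 2"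
    by (simp add: power2_eq_square)
  finally have "ennreal (m\<^sup>2 / 2) = (\<integral>\<^sup>+s. ennreal (m - s) * indicator {0..m} s \<partial>lborel)" ..
  also have "\<dots> \<le> (\<integral>\<^sup>+s. \<integral>\<^sup>+y. G y s \<partial>lborel \<partial>lborel)"
  proof (rule nn_integral_mono)
    fix s :: real
    have "(\<integral>\<^sup>+y. G y s \<partial>lborel) = (\<integral>\<^sup>+y. indicator {0..m} s * indicator {y. ennreal s \<le> \<rho> y} y \<partial>lborel)"
      by (intro nn_integral_cong) (simp add: G_def indicator_def)
    also have "\<dots> = indicator {0..m} s * emeasure lborel {y. ennreal s \<le> \<rho> y}"
      by (subst nn_integral_cmult_indicator) auto
    finally have eq: "(\<integral>\<^sup>+y. G y s \<partial>lborel) = indicator {0..m} s * emeasure lborel {y. ennreal s \<le> \<rho> y}" .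
    consider "s \<notin> {0..m}" | "s = 0" | "s = m" | "0 < s" "s < m" by force
    then show "ennreal (m - s) * indicator {0..m} s \<le> (\<integral>\<^sup>+y. G y s \<partial>lborel)"
    proof cases
      case 4
      then show ?thesis using level[of s] by (simp add: eq)
    qed (use \<open>m > 0\<close> in \<open>unfold eq, simp_all\<close>)
  qed
  also have "\<dots> = (\<integral>\<^sup>+y. \<integral>\<^sup>+s. G y s \<partial>lborel \<partial>lborel)"
    by (rule lborel_pair.Fubini') simp
  also have "\<dots> \<le> (\<integral>\<^sup>+y. \<rho> y \<partial>lborel)"
  proof (rule nn_integral_mono)
    fix y
    show "(\<integral>\<^sup>+s. G y s \<partial>lborel) \<le> \<rho> y"
    proof (cases "\<rho> y")
      case (real r)
      have "(\<integral>\<^sup>+s. G y s \<partial>lborel) \<le> (\<integral>\<^sup>+s. indicator {0..r} s \<partial>lborel)"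
        by (intro nn_integral_mono) (use real in \<open>auto simp: G_def indicator_def\<close>)
      also have "\<dots> = \<rho> y" using real by simp
      finally show ?thesis .
    qed simp
  qed
  finally show ?thesis .
qed

text \<open>
  Fubini in the coordinates \<open>(height, position along the row)\<close>. Heights are
  \<open>norm u\<close> times a Euclidean distance, and positions, in units of \<open>rot u\<close>, are Euclidean lengths
  divided by the same factor, so lattice lengths of rows integrate to the Euclidean area. The height
  replaces the second coordinate, or the first if \<open>u\<close> is horizontal.
\<close>

lemma slice_by_lattice_rows:
  fixes U :: "(real \<times> real) set"
  assumes "primitive u" and U[measurable]: "U \<in> sets borel"
  obtains \<rho> :: "real \<Rightarrow> ennreal" where "\<rho> \<in> borel_measurable borel"
    and "emeasure lborel U = (\<integral>\<^sup>+y. \<rho> y \<partial>lborel)"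
    and "\<And>x r. r > 0 \<Longrightarrow> closed_segment x (x + r *\<^sub>R of_lattice (rot u)) \<subseteq> U \<Longrightarrow>
      ennreal r \<le> \<rho> (of_lattice u \<bullet> x)"
proof -
  define u1 u2 :: real where "u1 = of_int (fst u)" and "u2 = of_int (snd u)"
  have u: "of_lattice u = (u1, u2)" "of_lattice (rot u) = (- u2, u1)"
    by (simp_all add: u1_def u2_def of_lattice_def rot_def)
  have nz: "u1 \<noteq> 0 \<or> u2 \<noteq> 0"
    using of_lattice_nonzero[OF assms(1)] by (simp add: u zero_prod_def)
  have [measurable]: "U \<in> sets (borel \<Otimes>\<^sub>M borel)" unfolding borel_prod by (rule U)
  have em: "emeasure lborel U = (\<integral>\<^sup>+x1. \<integral>\<^sup>+x2. indicator U (x1, x2) \<partial>lborel \<partial>lborel)"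
    by (subst lborel.nn_integral_fst) (simp_all add: lborel_prod)
  have seg: "(fst x - \<theta> * (r * u2), snd x + \<theta> * (r * u1)) \<in> U"
    if "closed_segment x (x + r *\<^sub>R of_lattice (rot u)) \<subseteq> U" "0 \<le> \<theta>" "\<theta> \<le> 1" for x r \<theta>
  proof -
    have "x + \<theta> *\<^sub>R (r *\<^sub>R of_lattice (rot u)) \<in> closed_segment x (x + r *\<^sub>R of_lattice (rot u))"
      using that by (auto simp: closed_segment_def algebra_simps intro!: exI[of _ \<theta>])
    moreover have "x + \<theta> *\<^sub>R (r *\<^sub>R of_lattice (rot u)) = (fst x - \<theta> * (r * u2), snd x + \<theta> * (r * u1))"
      by (simp add: u prod_eq_iff)
    ultimately show ?thesis using that by auto
  qed
  show thesis
  proof (cases "u2 = 0")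
    case False
    define \<rho> where "\<rho> y = (\<integral>\<^sup>+x1. ennreal \<bar>1 / u2\<bar> * indicator U (x1, - u1 * x1 / u2 + (1 / u2) * y) \<partial>lborel)" for y
    show thesis
    proof (rule that)
      show "\<rho> \<in> borel_measurable borel" unfolding \<rho>_def by measurable
      have "emeasure lborel U = (\<integral>\<^sup>+x1. \<integral>\<^sup>+y. ennreal \<bar>1 / u2\<bar> * indicator U (x1, - u1 * x1 / u2 + (1 / u2) * y) \<partial>lborel \<partial>lborel)"
        unfolding em
      proof (rule nn_integral_cong)
        fix x1
        show "(\<integral>\<^sup>+x2. indicator U (x1, x2) \<partial>lborel) =
          (\<integral>\<^sup>+y. ennreal \<bar>1 / u2\<bar> * indicator U (x1, - u1 * x1 / u2 + (1 / u2) * y) \<partial>lborel)"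
          using False
          by (subst nn_integral_real_affine[where c = "1 / u2" and t = "- u1 * x1 / u2"])
             (auto simp: nn_integral_cmult)
      qed
      also have "\<dots> = (\<integral>\<^sup>+y. \<rho> y \<partial>lborel)"
        unfolding \<rho>_def by (rule lborel_pair.Fubini') measurable
      finally show "emeasure lborel U = (\<integral>\<^sup>+y. \<rho> y \<partial>lborel)" .
    next
      fix x :: "real \<times> real" and r :: real
      assume r: "r > 0" "closed_segment x (x + r *\<^sub>R of_lattice (rot u)) \<subseteq> U"
      define I where "I = (if u2 > 0 then {fst x - r * u2..fst x} else {fst x..fst x - r * u2})"
      have I: "(x1, - u1 * x1 / u2 + (1 / u2) * (of_lattice u \<bullet> x)) \<in> U" if "x1 \<in> I" for x1
      proof -
        define \<theta> where "\<theta> = (fst x - x1) / (r * u2)"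
        have "0 \<le> \<theta>" "\<theta> \<le> 1" using that r(1) False
          by (auto simp: I_def \<theta>_def divide_le_eq zero_le_divide_iff mult_less_0_iff zero_less_mult_iff
            zero_le_mult_iff mult_le_0_iff split: if_splits)
        from seg[OF r(2) this] show ?thesis
        proof (rule back_subst[where P = "\<lambda>p. p \<in> U"])
          have "fst x - \<theta> * (r * u2) = x1" "\<theta> * (r * u1) = (fst x - x1) * u1 / u2"
            using r(1) False by (simp_all add: \<theta>_def)
          moreover have "snd x + (fst x - x1) * u1 / u2 = - u1 * x1 / u2 + (1 / u2) * (of_lattice u \<bullet> x)"
            using False by (simp add: u inner_prod_def field_simps)
          ultimately show "(fst x - \<theta> * (r * u2), snd x + \<theta> * (r * u1)) =
              (x1, - u1 * x1 / u2 + (1 / u2) * (of_lattice u \<bullet> x))" by simp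
        qed
      qed
      have "emeasure lborel I = ennreal (r * \<bar>u2\<bar>)"
        using r(1) False by (cases "u2 > 0") (simp_all add: I_def mult_le_0_iff)
      moreover have "r = \<bar>1 / u2\<bar> * (r * \<bar>u2\<bar>)" using False by simp
      ultimately have "ennreal r = ennreal \<bar>1 / u2\<bar> * emeasure lborel I"
        using ennreal_mult'[of "\<bar>1 / u2\<bar>" "r * \<bar>u2\<bar>"] by simp
      also have "\<dots> = (\<integral>\<^sup>+x1. ennreal \<bar>1 / u2\<bar> * indicator I x1 \<partial>lborel)"
        by (subst nn_integral_cmult_indicator) (auto simp: I_def)
      also have "\<dots> \<le> \<rho> (of_lattice u \<bullet> x)"
        unfolding \<rho>_def using I by (intro nn_integral_mono mult_left_mono) (auto simp: indicator_def)
      finally show "ennreal r \<le> \<rho> (of_lattice u \<bullet> x)" .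
    qed
  next
    case True
    then have "u1 \<noteq> 0" using nz by simp
    define \<rho> where "\<rho> y = ennreal \<bar>1 / u1\<bar> * (\<integral>\<^sup>+x2. indicator U (0 + (1 / u1) * y, x2) \<partial>lborel)" for y
    show thesis
    proof (rule that)
      show "\<rho> \<in> borel_measurable borel" unfolding \<rho>_def by measurable
      show "emeasure lborel U = (\<integral>\<^sup>+y. \<rho> y \<partial>lborel)"
        unfolding em \<rho>_def using \<open>u1 \<noteq> 0\<close>
        by (subst nn_integral_real_affine[where c = "1 / u1" and t = 0])
           (auto simp: nn_integral_cmult)
    next
      fix x :: "real \<times> real" and r :: real
      assume r: "r > 0" "closed_segment x (x + r *\<^sub>R of_lattice (rot u)) \<subseteq> U"
      define I where "I = (if u1 > 0 then {snd x..snd x + r * u1} else {snd x + r * u1..snd x})"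
      have I: "(0 + (1 / u1) * (of_lattice u \<bullet> x), x2) \<in> U" if "x2 \<in> I" for x2
      proof -
        define \<theta> where "\<theta> = (x2 - snd x) / (r * u1)"
        have "0 \<le> \<theta>" "\<theta> \<le> 1" using that r(1) \<open>u1 \<noteq> 0\<close>
          by (auto simp: I_def \<theta>_def divide_le_eq zero_le_divide_iff mult_less_0_iff zero_less_mult_iff
            zero_le_mult_iff mult_le_0_iff split: if_splits)
        from seg[OF r(2) this] show ?thesis
        proof (rule back_subst[where P = "\<lambda>p. p \<in> U"])
          have "\<theta> * (r * u1) = x2 - snd x" using r(1) \<open>u1 \<noteq> 0\<close> by (simp add: \<theta>_def)
          then show "(fst x - \<theta> * (r * u2), snd x + \<theta> * (r * u1)) =
              (0 + (1 / u1) * (of_lattice u \<bullet> x), x2)"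
            using True \<open>u1 \<noteq> 0\<close> by (simp add: u inner_prod_def)
        qed
      qed
      have "emeasure lborel I = ennreal (r * \<bar>u1\<bar>)"
        using r(1) \<open>u1 \<noteq> 0\<close> by (cases "u1 > 0") (simp_all add: I_def mult_le_0_iff)
      moreover have "r = \<bar>1 / u1\<bar> * (r * \<bar>u1\<bar>)" using \<open>u1 \<noteq> 0\<close> by simp
      ultimately have "ennreal r = ennreal \<bar>1 / u1\<bar> * emeasure lborel I"
        using ennreal_mult'[of "\<bar>1 / u1\<bar>" "r * \<bar>u1\<bar>"] by simp
      also have "emeasure lborel I = (\<integral>\<^sup>+x2. indicator I x2 \<partial>lborel)"
        by (auto simp: I_def)
      also have "ennreal \<bar>1 / u1\<bar> * \<dots> \<le> \<rho> (of_lattice u \<bullet> x)"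
        unfolding \<rho>_def using I by (intro mult_left_mono nn_integral_mono) (auto simp: indicator_def)
      finally show "ennreal r \<le> \<rho> (of_lattice u \<bullet> x)" .
    qed
  qed
qed

text \<open>
  The exclusion of integral heights costs nothing, since they form a null set.
\<close>

lemma area_ge_of_long_rows:
  fixes U :: "(real \<times> real) set" and m :: real
  assumes "primitive u" and "m > 0" and "compact U"
    and rows: "\<And>s. 0 < s \<Longrightarrow> s < m \<Longrightarrow> \<exists>\<alpha> \<beta>. m - s \<le> \<beta> - \<alpha> \<and>
      (\<forall>y. \<alpha> < y \<and> y < \<beta> \<and> y \<notin> \<int> \<longrightarrow> (\<exists>x r. of_lattice u \<bullet> x = y \<and> s \<le> r \<and>
        closed_segment x (x + r *\<^sub>R of_lattice (rot u)) \<subseteq> U))"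
  shows "m\<^sup>2 / 2 \<le> measure lborel U"
proof -
  have "U \<in> sets borel" using \<open>compact U\<close> by (simp add: compact_imp_closed)
  obtain \<rho> :: "real \<Rightarrow> ennreal" where [measurable]: "\<rho> \<in> borel_measurable borel"
    and em: "emeasure lborel U = (\<integral>\<^sup>+y. \<rho> y \<partial>lborel)"
    and row: "\<And>x r. r > 0 \<Longrightarrow> closed_segment x (x + r *\<^sub>R of_lattice (rot u)) \<subseteq> U \<Longrightarrow>
      ennreal r \<le> \<rho> (of_lattice u \<bullet> x)"
    using slice_by_lattice_rows[OF assms(1) \<open>U \<in> sets borel\<close>] by metis
  have "ennreal (m\<^sup>2 / 2) \<le> emeasure lborel U"
    unfolding em
  proof (rule nn_integral_ge_triangle)
    fix s :: real assume s: "0 < s" "s < m"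
    obtain \<alpha> \<beta> where ab: "m - s \<le> \<beta> - \<alpha>"
      "\<And>y. \<alpha> < y \<Longrightarrow> y < \<beta> \<Longrightarrow> y \<notin> \<int> \<Longrightarrow> \<exists>x r. of_lattice u \<bullet> x = y \<and> s \<le> r \<and>
        closed_segment x (x + r *\<^sub>R of_lattice (rot u)) \<subseteq> U"
      using rows[OF s] by metis
    have "{\<alpha><..<\<beta>} - \<int> \<subseteq> {y. ennreal s \<le> \<rho> y}"
    proof
      fix y assume "y \<in> {\<alpha><..<\<beta>} - \<int>"
      then obtain x r where "of_lattice u \<bullet> x = y" "s \<le> r"
        "closed_segment x (x + r *\<^sub>R of_lattice (rot u)) \<subseteq> U" using ab(2)[of y] by auto
      then show "y \<in> {y. ennreal s \<le> \<rho> y}"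
        using row[of r x] s by (auto intro: order_trans[OF ennreal_leI])
    qed
    then have "emeasure lborel ({\<alpha><..<\<beta>} - \<int>) \<le> emeasure lborel {y. ennreal s \<le> \<rho> y}"
      by (intro emeasure_mono) auto
    moreover have "emeasure lborel ({\<alpha><..<\<beta>} - \<int>) = emeasure lborel {\<alpha><..<\<beta>}"
      by (intro emeasure_Diff_null_set countable_imp_null_set_lborel) (auto intro: countable_int)
    moreover have "emeasure lborel {\<alpha><..<\<beta>} = ennreal (\<beta> - \<alpha>)" using ab(1) s by simp
    ultimately show "ennreal (m - s) \<le> emeasure lborel {y. ennreal s \<le> \<rho> y}"
      using ab(1) by (metis ennreal_leI order_trans)
  qed (use \<open>m > 0\<close> in auto)
  also have "emeasure lborel U = ennreal (measure lborel U)"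
    using emeasure_bounded_finite[OF compact_imp_bounded[OF \<open>compact U\<close>]]
    by (intro emeasure_eq_ennreal_measure) simp
  finally show ?thesis by simp
qed

section \<open>Edges and vertices of the curve\<close>

context tropical_polynomial begin

lemma maximizers_iff_le:
  "a \<in> maximizers A c Q \<longleftrightarrow>
    a \<in> A \<and> (\<forall>b\<in>A. of_lattice b \<bullet> Q + c b \<le> of_lattice a \<bullet> Q + c a)"
proof -
  obtain e where "e \<in> maximizers A c Q" using maximizers_nonempty by blast
  then show ?thesis using monomial_le_trop_poly[of _ Q] unfolding maximizers_iff by (metis order_antisym)
qed

lemma maximizers_row:
  assumes "Q \<in> trop_curve A c" "Q \<notin> vertices A c"
    and "a \<in> maximizers A c Q" "b \<in> maximizers A c Q" "d \<in> maximizers A c Q" "a \<noteq> b"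
  obtains k where "of_lattice d - of_lattice a = k *\<^sub>R (of_lattice b - of_lattice a)"
proof -
  have "aff_dim (dual_cell A c Q) \<noteq> 2" using assms by (simp add: vertices_def)
  moreover have "aff_dim (dual_cell A c Q) \<le> 2" using aff_dim_le_DIM[of "dual_cell A c Q"] by simp
  ultimately have "collinear (dual_cell A c Q)" by (simp add: collinear_aff_dim)
  then obtain w where w: "\<And>x y. x \<in> dual_cell A c Q \<Longrightarrow> y \<in> dual_cell A c Q \<Longrightarrow> \<exists>k. x - y = k *\<^sub>R w"
    unfolding collinear_def by blast
  have in_cell: "of_lattice e \<in> dual_cell A c Q" if "e \<in> maximizers A c Q" for e
    using that by (auto simp: dual_cell_def intro: hull_inc)
  obtain k where k: "of_lattice b - of_lattice a = k *\<^sub>R w" using w in_cell assms by metis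
  obtain l where l: "of_lattice d - of_lattice a = l *\<^sub>R w" using w in_cell assms by metis
  have "of_lattice b \<noteq> of_lattice a" using assms(6) injD[OF inj_of_lattice] by metis
  then have "k \<noteq> 0" using k by auto
  then have "of_lattice d - of_lattice a = (l / k) *\<^sub>R (of_lattice b - of_lattice a)" using k l by simp
  then show thesis by (rule that)
qed

text \<open>
  At a point of the curve that is not a vertex the maximizers are collinear, so two monomials that
  stay equal while moving from \<open>Q\<close> to \<open>Q'\<close> force all the others to stay equal to them.
\<close>

lemma maximizers_eq_if_subset:
  assumes "Q \<in> trop_curve A c - vertices A c" "Q' \<in> trop_curve A c"
    and sub: "maximizers A c Q' \<subseteq> maximizers A c Q"
  shows "maximizers A c Q = maximizers A c Q'"
proof
  have "card (maximizers A c Q') \<ge> 2" using assms(2) by (simp add: trop_curve_def)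
  then obtain a b where ab: "a \<in> maximizers A c Q'" "b \<in> maximizers A c Q'" "a \<noteq> b"
    by (meson card_2_iff' obtain_subset_with_card_n subsetD)
  show "maximizers A c Q \<subseteq> maximizers A c Q'"
  proof
    fix d assume d: "d \<in> maximizers A c Q"
    have abQ: "a \<in> maximizers A c Q" "b \<in> maximizers A c Q" using ab sub by auto
    obtain k where k: "of_lattice d - of_lattice a = k *\<^sub>R (of_lattice b - of_lattice a)"
      using maximizers_row[of Q a b d] assms(1) abQ d ab(3) by blast
    have "(of_lattice b - of_lattice a) \<bullet> (Q' - Q) = 0"
      using ab abQ by (simp add: maximizers_iff inner_diff_left inner_diff_right)
    then have "(of_lattice d - of_lattice a) \<bullet> (Q' - Q) = 0" unfolding k by simp
    then have "of_lattice d \<bullet> Q' + c d = of_lattice a \<bullet> Q' + c a"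
      using d abQ(1) by (simp add: maximizers_iff inner_diff_left inner_diff_right)
    then show "d \<in> maximizers A c Q'" using d ab(1) by (simp add: maximizers_iff)
  qed
qed (rule sub)

lemma closed_maximizing_region: "closed {Q. T \<subseteq> maximizers A c Q}"
proof -
  have "{Q. T \<subseteq> maximizers A c Q} = (\<Inter>a\<in>T. {Q. a \<in> maximizers A c Q})" by auto
  moreover have "closed {Q. a \<in> maximizers A c Q}" for a
  proof -
    have "{Q. a \<in> maximizers A c Q} =
        (\<Inter>b\<in>A. {Q. of_lattice b \<bullet> Q + c b \<le> of_lattice a \<bullet> Q + c a}) \<inter> {Q. a \<in> A}"
      by (auto simp: maximizers_iff_le)
    also have "closed \<dots>"
      by (intro closed_Int closed_INT ballI closed_Collect_le continuous_intros closed_Collect_const)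
    finally show ?thesis .
  qed
  ultimately show ?thesis by (simp add: closed_INT)
qed

lemma convex_cell: "convex {Q. maximizers A c Q = S}"
  unfolding convex_def
proof (intro ballI allI impI)
  fix Q Q' and k l :: real
  assume QQ: "Q \<in> {Q. maximizers A c Q = S}" "Q' \<in> {Q. maximizers A c Q = S}"
    and kl: "0 \<le> k" "0 \<le> l" "k + l = 1"
  define R where "R = k *\<^sub>R Q + l *\<^sub>R Q'"
  define val where "val a Q = of_lattice a \<bullet> Q + c a" for a Q
  have val: "val a R = k * val a Q + l * val a Q'" for a
  proof -
    have "k * c a + l * c a = c a" using kl by (simp flip: distrib_right)
    then show ?thesis by (simp add: val_def R_def inner_add_right algebra_simps)
  qed
  have iff: "a \<in> maximizers A c Q \<longleftrightarrow> a \<in> A \<and> val a Q = trop_poly A c Q" for a Q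
    by (simp add: maximizers_iff val_def)
  have le: "val a Q \<le> trop_poly A c Q" if "a \<in> A" for a Q
    using monomial_le_trop_poly[OF that] by (simp add: val_def)
  show "k *\<^sub>R Q + l *\<^sub>R Q' \<in> {Q. maximizers A c Q = S}"
  proof (cases "k = 0 \<or> l = 0")
    case True
    then have "R = Q \<or> R = Q'" using kl by (auto simp: R_def)
    then show ?thesis using QQ unfolding R_def[symmetric] by blast
  next
    case False
    then have pos: "k > 0" "l > 0" using kl by auto
    define M where "M = k * trop_poly A c Q + l * trop_poly A c Q'"
    obtain e where e: "e \<in> S" using maximizers_nonempty QQ by blast
    have leM: "val a R \<le> M" if "a \<in> A" for a
      unfolding val M_def using le[OF that] kl by (intro add_mono mult_left_mono) auto
    have "e \<in> maximizers A c Q" "e \<in> maximizers A c Q'" using e QQ by auto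
    then have "val e R = M" "e \<in> A" unfolding val M_def iff by auto
    then have "e \<in> maximizers A c R" using leM unfolding maximizers_iff_le val_def[symmetric] by simp
    then have M: "trop_poly A c R = M" using \<open>val e R = M\<close> by (simp add: iff)
    have "a \<in> maximizers A c R \<longleftrightarrow> a \<in> S" for a
    proof
      assume a: "a \<in> maximizers A c R"
      then have "a \<in> A" and "k * val a Q + l * val a Q' = M" using M by (auto simp: iff simp flip: val)
      moreover have "k * val a Q \<le> k * trop_poly A c Q" "l * val a Q' \<le> l * trop_poly A c Q'"
        using le[OF \<open>a \<in> A\<close>] kl by (simp_all only: mult_left_mono)
      ultimately have "k * val a Q = k * trop_poly A c Q" unfolding M_def by linarith
      then have "a \<in> maximizers A c Q" using pos \<open>a \<in> A\<close> by (simp add: iff)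
      then show "a \<in> S" using QQ by simp
    next
      assume "a \<in> S"
      then have "a \<in> maximizers A c Q" "a \<in> maximizers A c Q'" using QQ by auto
      then show "a \<in> maximizers A c R" unfolding iff M by (auto simp: val M_def)
    qed
    then show ?thesis by (auto simp: R_def)
  qed
qed

text \<open>
  The regions \<open>{Q. T \<subseteq> maximizers Q}\<close> are closed, and for the finitely many sets \<open>T\<close> of
  maximizers that occur they coincide, on the curve minus its vertices, with the disjoint cells \<open>{Q. maximizers Q = T}\<close>. So each cell is relatively open
  as well as closed, and being convex it is a whole component.
\<close>

lemma component_eq_cell:
  assumes C: "C \<in> components (trop_curve A c - vertices A c)" and "P \<in> C"
  shows "C = {Q. maximizers A c Q = maximizers A c P}"
proof
  define HV where "HV = trop_curve A c - vertices A c"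
  have C_sub: "C \<subseteq> HV" using in_components_subset[OF C] by (simp add: HV_def)
  define S where "S = maximizers A c P"
  define X where "X = {Q. S \<subseteq> maximizers A c Q}"
  define \<T> where "\<T> = maximizers A c ` HV - {S}"
  define Y where "Y = (\<Union>T\<in>\<T>. {Q. T \<subseteq> maximizers A c Q})"
  have "\<T> \<subseteq> Pow A" by (auto simp: \<T>_def maximizers_def)
  then have "finite \<T>" using finite_support by (meson finite_Pow_iff finite_subset)
  have "closed X" "closed Y"
    using closed_maximizing_region \<open>finite \<T>\<close> by (auto simp: X_def Y_def)
  moreover have "C \<subseteq> X \<union> Y" using C_sub by (auto simp: X_def Y_def \<T>_def)
  moreover have "X \<inter> Y \<inter> C = {}"
  proof (rule ccontr)
    assume "X \<inter> Y \<inter> C \<noteq> {}"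
    then obtain Q T where Q: "Q \<in> C" "S \<subseteq> maximizers A c Q" "T \<in> \<T>" "T \<subseteq> maximizers A c Q"
      by (auto simp: X_def Y_def)
    then obtain R where "R \<in> HV" "T = maximizers A c R" "T \<noteq> S" by (auto simp: \<T>_def)
    moreover have "Q \<in> HV" "P \<in> HV" using Q C_sub \<open>P \<in> C\<close> by auto
    ultimately have "maximizers A c Q = S" "maximizers A c Q = T"
      using maximizers_eq_if_subset[of Q P] maximizers_eq_if_subset[of Q R] Q
      by (auto simp: HV_def S_def)
    then show False using \<open>T \<noteq> S\<close> by simp
  qed
  moreover have "connected C" using C by (rule in_components_connected)
  ultimately have "X \<inter> C = {} \<or> Y \<inter> C = {}" unfolding connected_closed by blast
  moreover have "P \<in> X \<inter> C" using \<open>P \<in> C\<close> by (simp add: X_def S_def)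
  ultimately have "C \<subseteq> X"
    using \<open>C \<subseteq> X \<union> Y\<close> by blast
  show "C \<subseteq> {Q. maximizers A c Q = maximizers A c P}"
  proof
    fix Q assume "Q \<in> C"
    then have "Q \<in> HV" "P \<in> HV" "maximizers A c P \<subseteq> maximizers A c Q"
      using \<open>C \<subseteq> X\<close> C_sub \<open>P \<in> C\<close> by (auto simp: X_def S_def)
    then show "Q \<in> {Q. maximizers A c Q = maximizers A c P}"
      using maximizers_eq_if_subset[of Q P] by (simp add: HV_def)
  qed
  have "{Q. maximizers A c Q = maximizers A c P} \<subseteq> trop_curve A c - vertices A c"
    using C_sub \<open>P \<in> C\<close> by (auto simp: HV_def trop_curve_def vertices_def dual_cell_def)
  then show "{Q. maximizers A c Q = maximizers A c P} \<subseteq> C"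
    using \<open>P \<in> C\<close> by (intro components_maximal[OF C] convex_connected convex_cell) auto
qed

text \<open>
  A convex set and its closure have the same relative interior, so the point chosen in the relative
  interior of the closed edge belongs to the component of which the edge is the closure.
\<close>

lemma dual_edge_eq_dual_cell:
  assumes "P \<in> trop_curve A c" "P \<notin> vertices A c" "E \<in> edges A c" "P \<in> E"
  shows "dual_edge A c E = dual_cell A c P"
proof -
  obtain C where C: "C \<in> components (trop_curve A c - vertices A c)" "E = closure C"
    using assms(3) by (auto simp: edges_def)
  obtain T where T: "closed T" "C = (trop_curve A c - vertices A c) \<inter> T"
    using closedin_component[OF C(1)] by (auto simp: closedin_closed)
  have "closure C \<subseteq> T" using T by (intro closure_minimal) auto
  then have "P \<in> C" using T assms C(2) by auto
  then have cell: "C = {Q. maximizers A c Q = maximizers A c P}" by (rule component_eq_cell[OF C(1)])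
  then have "convex C" by (simp add: convex_cell)
  then have "rel_interior E = rel_interior C" "rel_interior C \<noteq> {}"
    using convex_rel_interior_closure rel_interior_eq_empty \<open>P \<in> C\<close> C(2) by auto
  then have "(SOME Q. Q \<in> rel_interior E) \<in> C"
    using rel_interior_subset some_in_eq by blast
  then show ?thesis using cell by (auto simp: dual_edge_def dual_cell_def)
qed

text \<open>
  Two points with the same maximizers confine their dual cell to a line orthogonal to the difference
  of the points, so a vertex is determined by its set of maximizers.
\<close>

lemma finite_vertices: "finite (vertices A c)"
proof (rule inj_on_finite)
  show "inj_on (maximizers A c) (vertices A c)"
  proof (rule inj_onI, rule ccontr)
    fix Q Q' assume Q: "Q \<in> vertices A c" "maximizers A c Q = maximizers A c Q'" "Q \<noteq> Q'"
    obtain a where a: "a \<in> maximizers A c Q" using maximizers_nonempty by blast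
    have "of_lattice ` maximizers A c Q \<subseteq> {x. (Q - Q') \<bullet> x = (Q - Q') \<bullet> of_lattice a}"
    proof
      fix x assume "x \<in> of_lattice ` maximizers A c Q"
      then obtain b where x: "x = of_lattice b" and b: "b \<in> maximizers A c Q" by blast
      have "b \<in> maximizers A c Q'" "a \<in> maximizers A c Q'" using a b Q by auto
      then show "x \<in> {x. (Q - Q') \<bullet> x = (Q - Q') \<bullet> of_lattice a}"
        unfolding x using a b by (simp add: maximizers_iff inner_diff_left inner_commute[of Q] inner_commute[of Q'])
    qed
    then have "dual_cell A c Q \<subseteq> {x. (Q - Q') \<bullet> x = (Q - Q') \<bullet> of_lattice a}"
      unfolding dual_cell_def by (intro hull_minimal convex_hyperplane)
    from aff_dim_subset[OF this] have "aff_dim (dual_cell A c Q) \<le> 1"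
      using Q(3) by simp
    then show False using Q(1) by (simp add: vertices_def)
  qed
  show "maximizers A c ` vertices A c \<subseteq> Pow A" by (auto simp: maximizers_def)
  show "finite (Pow A)" using finite_support by simp
qed

end

text \<open>
  The width of the hull of finitely many points is attained at two of these points.
\<close>

lemma wide_in_direction:
  assumes "finite A" "A \<noteq> {}" "admissible m A" "primitive u"
  shows "\<exists>a\<in>A. \<exists>b\<in>A. of_lattice u \<bullet> (of_lattice a - of_lattice b) \<ge> real m"
proof -
  define h where "h x = of_lattice u \<bullet> x" for x
  obtain a where "a \<in> A" using assms by blast
  then have a: "of_lattice a \<in> newton_polygon A" by (auto simp: newton_polygon_def intro: hull_inc)
  have widths: "0 \<le> width_dir w (newton_polygon A)" for w
  proof -
    define W where "W = {of_lattice w \<bullet> (x - y) |x y. x \<in> newton_polygon A \<and> y \<in> newton_polygon A}"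
    have "compact (newton_polygon A)"
      unfolding newton_polygon_def using assms by (intro finite_imp_compact_convex_hull) auto
    moreover have "W = (\<lambda>p. of_lattice w \<bullet> (fst p - snd p)) ` (newton_polygon A \<times> newton_polygon A)"
      by (force simp: W_def)
    ultimately have "compact W"
      by (auto intro!: compact_continuous_image compact_Times continuous_intros)
    then have "bdd_above W" by (intro bounded_imp_bdd_above compact_imp_bounded)
    have "of_lattice w \<bullet> (of_lattice a - of_lattice a) \<in> W" unfolding W_def using a by blast
    then have "0 \<in> W" by simp
    then have "0 \<le> Sup W" using \<open>bdd_above W\<close> by (rule cSup_upper)
    then show ?thesis by (simp add: width_dir_def W_def)
  qed
  have "min_width (newton_polygon A) \<le> width_dir u (newton_polygon A)"
    unfolding min_width_def
  proof (rule cInf_lower)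
    show "width_dir u (newton_polygon A) \<in> {width_dir w (newton_polygon A) |w. primitive w}"
      using assms(4) by blast
    show "bdd_below {width_dir w (newton_polygon A) |w. primitive w}"
      using widths by (intro bdd_belowI[of _ 0]) blast
  qed
  then have m: "real m \<le> width_dir u (newton_polygon A)" using assms(3) by (simp add: admissible_def)
  define hs where "hs = (\<lambda>a. h (of_lattice a)) ` A"
  have hs: "finite hs" "hs \<noteq> {}" using assms by (auto simp: hs_def)
  have up: "newton_polygon A \<subseteq> {x. h x \<le> Max hs}"
    unfolding newton_polygon_def h_def using hs(1)
    by (intro hull_minimal) (auto simp: convex_halfspace_le hs_def h_def)
  have lo: "newton_polygon A \<subseteq> {x. h x \<ge> Min hs}"
    unfolding newton_polygon_def h_def using hs(1)
    by (intro hull_minimal) (auto simp: convex_halfspace_ge hs_def h_def)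
  have "width_dir u (newton_polygon A) \<le> Max hs - Min hs"
    unfolding width_dir_def
  proof (rule cSup_least)
    show "{of_lattice u \<bullet> (x - y) |x y. x \<in> newton_polygon A \<and> y \<in> newton_polygon A} \<noteq> {}"
      using a by blast
  next
    fix w assume "w \<in> {of_lattice u \<bullet> (x - y) |x y. x \<in> newton_polygon A \<and> y \<in> newton_polygon A}"
    then obtain x y where xy: "w = h x - h y" "x \<in> newton_polygon A" "y \<in> newton_polygon A"
      by (auto simp: h_def inner_diff_right)
    then have "h x \<le> Max hs" "Min hs \<le> h y" using up lo by auto
    then show "w \<le> Max hs - Min hs" using xy(1) by simp
  qed
  moreover obtain a where "a \<in> A" "Max hs = h (of_lattice a)" using Max_in[OF hs] by (auto simp: hs_def)
  moreover obtain b where "b \<in> A" "Min hs = h (of_lattice b)" using Min_in[OF hs] by (auto simp: hs_def)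
  ultimately have "a \<in> A" "b \<in> A" "of_lattice u \<bullet> (of_lattice a - of_lattice b) \<ge> real m"
    using m by (simp_all add: h_def inner_diff_right)
  then show ?thesis by blast
qed

lemma primitive_normal:
  assumes "a \<noteq> b"
  obtains u where "primitive u" "of_lattice u \<bullet> (of_lattice b - of_lattice a) = 0"
proof -
  define d1 d2 where "d1 = fst b - fst a" and "d2 = snd b - snd a"
  define g where "g = gcd d1 d2"
  have "g \<noteq> 0" using assms by (auto simp: g_def d1_def d2_def prod_eq_iff)
  obtain e1 e2 where e: "d1 = e1 * g" "d2 = e2 * g" "coprime e1 e2"
    using gcd_coprime_exists[of d1 d2] \<open>g \<noteq> 0\<close> unfolding g_def by blast
  have "primitive (- e2, e1)" using e by (simp add: primitive_def coprime_commute)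
  moreover have "of_lattice b - of_lattice a = (of_int d1, of_int d2)"
    by (simp add: of_lattice_def d1_def d2_def)
  then have "of_lattice (- e2, e1) \<bullet> (of_lattice b - of_lattice a) = 0"
    unfolding e(1,2) by (simp add: of_lattice_def inner_prod_def)
  ultimately show thesis by (rule that)
qed

section \<open>Area of the influenced set\<close>

theorem theorem1:
  fixes A :: "(int \<times> int) set"
    and c :: "int \<times> int \<Rightarrow> real"
    and m :: nat
    and P :: "real \<times> real"
  assumes "finite A" and "A \<noteq> {}"
    and "m > 0"
    and "admissible m A"
    and "P \<in> trop_curve A c"
    and "P \<notin> vertices A c"
    and "mult_eq A c P m"
  shows "area_infl A c P \<ge> 1 / 2 * (real m)\<^sup>2 \<and>
    (\<forall>E\<in>edges A c. P \<in> E \<longrightarrow> lattice_length (dual_edge A c E) \<ge> real m)"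
proof -
  interpret C: tropical_polynomial A c using assms by unfold_locales
  define c' where "c' = recentre P c"
  interpret C': tropical_polynomial A c' using assms by unfold_locales
  have max': "maximizers A c' Q = maximizers A c (P + Q)" for Q
    by (simp add: c'_def maximizers_recentre)
  have cell': "dual_cell A c' Q = dual_cell A c (P + Q)" for Q
    by (simp add: c'_def dual_cell_recentre)
  have thick: "thick m (newton_section A c' \<mu>)" for \<mu>
    using assms(7) by (simp add: mult_eq_def mult_ge_def c'_def)
  have two: "card (maximizers A c P) \<ge> 2" using assms(5) by (simp add: trop_curve_def)
  have length: "lattice_length (dual_cell A c P) \<ge> real m"
  proof -
    have "thick m (dual_cell A c P)"
      using thick[of "trop_poly A c' 0"] by (simp add: C'.newton_section_top cell')
    moreover have "convex hull (dual_cell A c P) = dual_cell A c P" by (simp add: dual_cell_def)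
    moreover have "dual_cell A c P \<noteq> {}" using C.maximizers_nonempty by (simp add: dual_cell_def)
    moreover have "aff_dim (dual_cell A c P) \<noteq> 2" using assms(5,6) by (simp add: vertices_def)
    ultimately show ?thesis by (simp add: thick_def)
  qed
  obtain a b where ab: "a \<in> maximizers A c P" "b \<in> maximizers A c P" "a \<noteq> b"
    using two by (meson card_2_iff' obtain_subset_with_card_n subsetD)
  obtain u where u: "primitive u" "of_lattice u \<bullet> (of_lattice b - of_lattice a) = 0"
    using primitive_normal[OF ab(3)] by blast
  interpret thick_origin A c' m u "of_lattice u \<bullet> of_lattice a"
  proof unfold_locales
    show "card (maximizers A c' 0) \<ge> 2" using two by (simp add: max')
    show "of_lattice u \<bullet> of_lattice d = of_lattice u \<bullet> of_lattice a" if "d \<in> maximizers A c' 0" for d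
    proof -
      have "d \<in> maximizers A c P" using that by (simp add: max')
      then obtain k where "of_lattice d - of_lattice a = k *\<^sub>R (of_lattice b - of_lattice a)"
        using C.maximizers_row[OF assms(5,6) ab(1,2) _ ab(3)] by blast
      then have "of_lattice u \<bullet> (of_lattice d - of_lattice a) = 0" using u(2) by simp
      then show ?thesis by (simp add: inner_diff_right)
    qed
    show "\<exists>a\<in>A. \<exists>b\<in>A. of_lattice u \<bullet> (of_lattice a - of_lattice b) \<ge> real m"
      by (rule wide_in_direction[OF assms(1,2,4) u(1)])
  qed (use u thick in auto)
  have fin: "finite (influenced A c P)"
    using C.finite_vertices by (rule finite_subset[rotated]) (auto simp: influenced_def influenced_dir_def)
  define U where "U = (\<Union>V\<in>influenced A c P. dual_cell A c V)"
  have cells: "compact (dual_cell A c V)" "convex (dual_cell A c V)" for V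
    by (simp_all add: dual_cell_def finite_imp_compact_convex_hull C.finite_maximizers)
  have in_infl: "P + on_line t \<in> influenced A c P"
    if dim: "aff_dim (dual_cell A c' (on_line t)) = 2"
      and curve: "\<forall>\<theta>\<in>{0..1}. card (maximizers A c' (on_line (\<theta> * t))) \<ge> 2" for t
  proof -
    have on: "P + on_line (\<theta> * t) \<in> trop_curve A c" if "\<theta> \<in> {0..1}" for \<theta>
      using curve that by (simp add: trop_curve_def max')
    have vert: "P + on_line t \<in> vertices A c"
      using dim on[of 1] by (simp add: vertices_def cell')
    have "closed_segment P (P + on_line t) \<subseteq> trop_curve A c \<inter> lattice_line P u"
    proof
      fix z assume "z \<in> closed_segment P (P + on_line t)"
      then obtain \<theta> where \<theta>: "\<theta> \<in> {0..1}" "z = (1 - \<theta>) *\<^sub>R P + \<theta> *\<^sub>R (P + on_line t)"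
        by (auto simp: closed_segment_def)
      then have z: "z = P + on_line (\<theta> * t)" by (simp add: algebra_simps)
      then show "z \<in> trop_curve A c \<inter> lattice_line P u"
        using on[OF \<theta>(1)] by (auto simp: lattice_line_def)
    qed
    then have "closed_segment P (P + on_line t) \<subseteq> long_edge A c P u"
      unfolding long_edge_def by (intro connected_component_maximal connected_segment) auto
    then have "P + on_line t \<in> influenced_dir A c P u"
      using vert by (auto simp: influenced_dir_def)
    then show ?thesis using u(1) unfolding influenced_def by blast
  qed
  have "(real m)\<^sup>2 / 2 \<le> measure lborel U"
  proof (rule area_ge_of_long_rows[OF u(1)])
    show "real m > 0" using assms(3) by simp
    show "compact U" unfolding U_def using fin cells by (intro compact_UN) auto
    fix s :: real assume s: "0 < s" "s < real m"
    obtain \<alpha> \<beta> where \<alpha>\<beta>: "\<beta> - \<alpha> \<ge> real m - s"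
      and rows: "\<forall>y. \<alpha> < y \<and> y < \<beta> \<and> y \<notin> \<int> \<longrightarrow> (\<exists>t. row_length_ge s t y \<and>
        aff_dim (dual_cell A c' (on_line t)) = 2 \<and>
        (\<forall>\<theta>\<in>{0..1}. card (maximizers A c' (on_line (\<theta> * t))) \<ge> 2))"
      using long_rows_on_long_edge[OF s] by blast
    have "\<exists>x r. height x = y \<and> s \<le> r \<and> closed_segment x (x + r *\<^sub>R of_lattice (rot u)) \<subseteq> U"
      if y: "\<alpha> < y" "y < \<beta>" "y \<notin> \<int>" for y
    proof -
      obtain t where t: "row_length_ge s t y" "P + on_line t \<in> influenced A c P"
        using rows y in_infl by blast
      obtain x r where x: "x \<in> dual_cell A c (P + on_line t)"
        "x + r *\<^sub>R of_lattice (rot u) \<in> dual_cell A c (P + on_line t)" "height x = y" "r \<ge> s"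
        using t(1) by (auto simp: row_length_ge_def cell')
      then have "closed_segment x (x + r *\<^sub>R of_lattice (rot u)) \<subseteq> U"
        using closed_segment_subset[OF x(1,2) cells(2)] t(2) by (auto simp: U_def)
      then show ?thesis using x by blast
    qed
    then show "\<exists>\<alpha> \<beta>. real m - s \<le> \<beta> - \<alpha> \<and>
      (\<forall>y. \<alpha> < y \<and> y < \<beta> \<and> y \<notin> \<int> \<longrightarrow> (\<exists>x r. height x = y \<and> s \<le> r \<and>
        closed_segment x (x + r *\<^sub>R of_lattice (rot u)) \<subseteq> U))"
      using \<alpha>\<beta> by blast
  qed
  also have "measure lborel U \<le> area_infl A c P"
    unfolding U_def area_infl_def using fin cells
    by (intro measure_UNION_le) (auto simp: compact_imp_closed)
  finally show ?thesis
    using C.dual_edge_eq_dual_cell[OF assms(5,6)] length by auto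
qed

end
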